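(* Let $\mathcal H$ be a multiplicative representation. There is a constant $c>0$ (depending only on $\mathcal H$) such that for every lowest weight vector $f\in\mathcal H^{\mathrm{fin}}$, $$\|\exp(c\sqrt{\Delta})(|f|^2)\|_{\mathcal H}<\infty,$$ where $|f|^2=f\bar f$.
   Context: $G=\mathrm{PSL}_2(\mathbf R)$, $K=\mathrm{PSO}_2(\mathbf R)$, $\mathfrak g=\mathfrak{sl}_2(\mathbf C)$, $H=\frac1{2i}\begin{pmatrix}0&1\\-1&0\end{pmatrix}$, $E=\frac12\begin{pmatrix}1&i\\i&-1\end{pmatrix}$, $\bar E$ its complex conjugate; Casimir $\Delta=-H^2-\frac12(E\bar E+\bar EE)$. A smooth vector $v$ has weight $n$ if $Hv=nv$. A lowest weight vector is a nonzero smooth vector of nonzero weight with $\bar Ef=0$. A multiplicative representation is a unitary $G$-representation $\mathcal H$ with discrete spectrum (Hilbert sum of irreducibles, finitely many with Casimir eigenvalue in any bounded set), with $\mathcal H^{\rm fin}$ the algebraic sum of $K$-finite vectors of the summands, together with a bilinear map $\mathcal H^{\rm fin}\times\mathcal H^{\rm fin}\to\mathcal H^\infty$ (smooth vectors) that is commutative, has a unit $\mathbf 1$ of norm $1$ with $\mathcal H^G=\mathbf C\mathbf 1$, obeys the product rule for $\mathfrak g$, admits conjugates $\bar\alpha\in\mathcal H^{\rm fin}$ with $\langle\alpha\beta,\gamma\rangle=\langle\beta,\bar\alpha\gamma\rangle$ for all $\beta,\gamma$, and satisfies crossing symmetry $\langle\alpha_1\alpha_2,\bar\alpha_3\bar\alpha_4\rangle=\langle\alpha_{\sigma(1)}\alpha_{\sigma(2)},\bar\alpha_{\sigma(3)}\bar\alpha_{\sigma(4)}\rangle$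 for $\sigma\in S_4$. For $v\in\mathcal H$ and $h:\mathbf R\to\mathbf C$, $\|h(\Delta)v\|=(\sum_\lambda|h(\lambda)|^2\|\mathbf 1_{\Delta=\lambda}v\|^2)^{1/2}\in[0,\infty]$, where $\mathbf 1_{\Delta=\lambda}$ is the orthogonal projection onto the closure of the $\lambda$-eigenspace of $\Delta$ on smooth vectors (here $|f|^2$ is $K$-invariant so only $\lambda\ge0$ contribute). *)

theory Defs
  imports "HOL-Analysis.Analysis"
begin

text \<open>The library has no complex vector spaces.  A complex Hilbert space is encoded as a
real Banach space of type 'h together with a complex structure J (multiplication by i)
and a complex inner product ip (linear in the first, conjugate linear in the second
argument) inducing the norm.\<close>

definition cscale :: "('h::real_normed_vector \<Rightarrow> 'h) \<Rightarrow> complex \<Rightarrow> 'h \<Rightarrow> 'h" where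
  "cscale J z v = Re z *\<^sub>R v + Im z *\<^sub>R J v"

definition complex_hilbert ::
  "('h::{real_normed_vector,banach} \<Rightarrow> 'h) \<Rightarrow> ('h \<Rightarrow> 'h \<Rightarrow> complex) \<Rightarrow> bool" where
  "complex_hilbert J ip \<longleftrightarrow>
     linear J \<and> (\<forall>v. J (J v) = - v) \<and>
     (\<forall>u v w. ip (u + v) w = ip u w + ip v w) \<and>
     (\<forall>z u w. ip (cscale J z u) w = z * ip u w) \<and>
     (\<forall>u v. ip v u = cnj (ip u v)) \<and>
     (\<forall>v. norm v = sqrt (Re (ip v v)))"

definition csubspace :: "('h::real_normed_vector \<Rightarrow> 'h) \<Rightarrow> 'h set \<Rightarrow> bool" where
  "csubspace J M \<longleftrightarrow> 0 \<in> M \<and> (\<forall>u\<in>M. \<forall>v\<in>M. u + v \<in> M) \<and> (\<forall>z. \<forall>v\<in>M. cscale J z v \<in> M)"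

definition oproj :: "('h::real_normed_vector \<Rightarrow> 'h \<Rightarrow> complex) \<Rightarrow> 'h set \<Rightarrow> 'h \<Rightarrow> 'h" where
  "oproj ip M v = (THE m. m \<in> M \<and> (\<forall>u\<in>M. ip (v - m) u = 0))"

text \<open>Elements of PSL_2(R) are represented by matrices of determinant 1; a representation
of PSL_2(R) is a representation of SL_2(R) with \<pi>(-g) = \<pi>(g).\<close>

definition SL2 :: "(real^2^2) set" where
  "SL2 = {g. det g = 1}"

text \<open>The one-parameter subgroups exp(tX) for the real basis
X = [[0,1],[-1,0]], [[1,0],[0,-1]], [[0,1],[0,0]] of sl_2(R).  K = PSO_2 = image of rotm.\<close>
definition rotm :: "real \<Rightarrow> real^2^2" where
  "rotm t = vector [vector [cos t, sin t], vector [- sin t, cos t]]"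
definition diagm :: "real \<Rightarrow> real^2^2" where
  "diagm t = vector [vector [exp t, 0], vector [0, exp (- t)]]"
definition nilm :: "real \<Rightarrow> real^2^2" where
  "nilm t = vector [vector [1, t], vector [0, 1]]"

definition unitary_rep ::
  "('h::{real_normed_vector,banach} \<Rightarrow> 'h) \<Rightarrow> ('h \<Rightarrow> 'h \<Rightarrow> complex) \<Rightarrow> (real^2^2 \<Rightarrow> 'h \<Rightarrow> 'h) \<Rightarrow> bool" where
  "unitary_rep J ip \<pi> \<longleftrightarrow>
     complex_hilbert J ip \<and>
     \<pi> (mat 1) = id \<and>
     (\<forall>g\<in>SL2. \<pi> (- g) = \<pi> g) \<and>
     (\<forall>g\<in>SL2. \<forall>h\<in>SL2. \<pi> (g ** h) = \<pi> g \<circ> \<pi> h) \<and>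
     (\<forall>g\<in>SL2. \<forall>u v. \<pi> g (u + v) = \<pi> g u + \<pi> g v) \<and>
     (\<forall>g\<in>SL2. \<forall>z v. \<pi> g (cscale J z v) = cscale J z (\<pi> g v)) \<and>
     (\<forall>g\<in>SL2. \<forall>u v. ip (\<pi> g u) (\<pi> g v) = ip u v) \<and>
     (\<forall>v. continuous_on SL2 (\<lambda>g. \<pi> g v))"

definition Dgen :: "(real^2^2 \<Rightarrow> 'h::real_normed_vector \<Rightarrow> 'h) \<Rightarrow> (real \<Rightarrow> real^2^2) \<Rightarrow> 'h \<Rightarrow> 'h" where
  "Dgen \<pi> \<gamma> v = vector_derivative (\<lambda>t. \<pi> (\<gamma> t) v) (at 0)"

text \<open>Smooth vectors: all iterated Lie derivatives exist (largest set of vectors closed under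
differentiation along a basis of the Lie algebra).\<close>
definition smooth_vecs :: "(real^2^2 \<Rightarrow> 'h::real_normed_vector \<Rightarrow> 'h) \<Rightarrow> 'h set" where
  "smooth_vecs \<pi> = \<Union>{S. \<forall>v\<in>S. \<forall>\<gamma>\<in>{rotm, diagm, nilm}.
        (\<lambda>t. \<pi> (\<gamma> t) v) differentiable (at 0) \<and> Dgen \<pi> \<gamma> v \<in> S}"

definition opH :: "('h::real_normed_vector \<Rightarrow> 'h) \<Rightarrow> (real^2^2 \<Rightarrow> 'h \<Rightarrow> 'h) \<Rightarrow> 'h \<Rightarrow> 'h" where
  "opH J \<pi> v = cscale J (1 / (2 * \<i>)) (Dgen \<pi> rotm v)"
definition opE :: "('h::real_normed_vector \<Rightarrow> 'h) \<Rightarrow> (real^2^2 \<Rightarrow> 'h \<Rightarrow> 'h) \<Rightarrow> 'h \<Rightarrow> 'h" where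
  "opE J \<pi> v = cscale J (1/2) (Dgen \<pi> diagm v) + cscale J \<i> (Dgen \<pi> nilm v)
      + cscale J (- \<i> / 2) (Dgen \<pi> rotm v)"
definition opEb :: "('h::real_normed_vector \<Rightarrow> 'h) \<Rightarrow> (real^2^2 \<Rightarrow> 'h \<Rightarrow> 'h) \<Rightarrow> 'h \<Rightarrow> 'h" where
  "opEb J \<pi> v = cscale J (1/2) (Dgen \<pi> diagm v) + cscale J (- \<i>) (Dgen \<pi> nilm v)
      + cscale J (\<i> / 2) (Dgen \<pi> rotm v)"

definition casimir :: "('h::real_normed_vector \<Rightarrow> 'h) \<Rightarrow> (real^2^2 \<Rightarrow> 'h \<Rightarrow> 'h) \<Rightarrow> 'h \<Rightarrow> 'h" where
  "casimir J \<pi> v = - opH J \<pi> (opH J \<pi> v)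
      - cscale J (1/2) (opE J \<pi> (opEb J \<pi> v) + opEb J \<pi> (opE J \<pi> v))"

definition invariant_sub :: "(real^2^2 \<Rightarrow> 'h::real_normed_vector \<Rightarrow> 'h) \<Rightarrow> 'h set \<Rightarrow> bool" where
  "invariant_sub \<pi> M \<longleftrightarrow> (\<forall>g\<in>SL2. \<pi> g ` M \<subseteq> M)"

definition irreducible_sub ::
  "('h::real_normed_vector \<Rightarrow> 'h) \<Rightarrow> (real^2^2 \<Rightarrow> 'h \<Rightarrow> 'h) \<Rightarrow> 'h set \<Rightarrow> bool" where
  "irreducible_sub J \<pi> M \<longleftrightarrow>
     closed M \<and> csubspace J M \<and> invariant_sub \<pi> M \<and> M \<noteq> {0::'h} \<and>
     (\<forall>N. closed N \<and> csubspace J N \<and> invariant_sub \<pi> N \<and> N \<subseteq> M \<longrightarrow> N = {0} \<or> N = M)"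

text \<open>K-finite: the K-orbit spans a finite-dimensional space (finite dimension over R
is the same as over C).\<close>
definition Kfinite :: "(real^2^2 \<Rightarrow> 'h::real_normed_vector \<Rightarrow> 'h) \<Rightarrow> 'h \<Rightarrow> bool" where
  "Kfinite \<pi> v \<longleftrightarrow> (\<exists>B. finite B \<and> range (\<lambda>t. \<pi> (rotm t) v) \<subseteq> span (B::'h set))"

text \<open>Discrete spectrum with finite part Hfin: H is the Hilbert sum of the irreducible
summands V i (i \<in> I), finitely many of which have Casimir eigenvalue in any bounded set,
and Hfin is the algebraic sum of the K-finite vectors of the summands.  (The index set can
be taken countable, hence a set of naturals, by the finiteness condition.)  The real span
of the union of the complex subspaces of K-finite vectors equals their complex span.\<close>
definition discrete_spectrum ::
  "('h::real_normed_vector \<Rightarrow> 'h) \<Rightarrow> ('h \<Rightarrow> 'h \<Rightarrow> complex) \<Rightarrow> (real^2^2 \<Rightarrow> 'h \<Rightarrow> 'h) \<Rightarrow> 'h set \<Rightarrow> bool" where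
  "discrete_spectrum J ip \<pi> Hfin \<longleftrightarrow>
     (\<exists>(I::nat set) (V::nat \<Rightarrow> 'h set).
        (\<forall>i\<in>I. irreducible_sub J \<pi> (V i)) \<and>
        (\<forall>i\<in>I. \<forall>j\<in>I. i \<noteq> j \<longrightarrow> (\<forall>u\<in>V i. \<forall>v\<in>V j. ip u v = 0)) \<and>
        closure (span (\<Union>i\<in>I. V i)) = UNIV \<and>
        (\<forall>B::real. finite {i\<in>I. \<exists>l::complex. cmod l \<le> B \<and>
              (\<forall>v \<in> V i \<inter> smooth_vecs \<pi>. casimir J \<pi> v = cscale J l v)}) \<and>
        Hfin = span (\<Union>i\<in>I. {v\<in>V i. Kfinite \<pi> v}))"

definition conjv :: "('h::real_normed_vector \<Rightarrow> 'h \<Rightarrow> complex) \<Rightarrow> 'h set \<Rightarrow> ('h \<Rightarrow> 'h \<Rightarrow> 'h) \<Rightarrow> 'h \<Rightarrow> 'h" where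
  "conjv ip Hfin mul a =
     (THE x. x \<in> Hfin \<and> (\<forall>b\<in>Hfin. \<forall>c\<in>Hfin. ip (mul a b) c = ip b (mul x c)))"

definition multiplicative_rep ::
  "('h::{real_normed_vector,banach} \<Rightarrow> 'h) \<Rightarrow> ('h \<Rightarrow> 'h \<Rightarrow> complex) \<Rightarrow> (real^2^2 \<Rightarrow> 'h \<Rightarrow> 'h)
     \<Rightarrow> 'h set \<Rightarrow> ('h \<Rightarrow> 'h \<Rightarrow> 'h) \<Rightarrow> 'h \<Rightarrow> bool" where
  "multiplicative_rep J ip \<pi> Hfin mul one \<longleftrightarrow>
     unitary_rep J ip \<pi> \<and>
     discrete_spectrum J ip \<pi> Hfin \<and>
     \<comment> \<open>bilinear map Hfin x Hfin \<rightarrow> smooth vectors\<close>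
     (\<forall>a\<in>Hfin. \<forall>b\<in>Hfin. mul a b \<in> smooth_vecs \<pi>) \<and>
     (\<forall>a\<in>Hfin. \<forall>b\<in>Hfin. \<forall>c\<in>Hfin. mul (a + b) c = mul a c + mul b c) \<and>
     (\<forall>a\<in>Hfin. \<forall>b\<in>Hfin. \<forall>c\<in>Hfin. mul a (b + c) = mul a b + mul a c) \<and>
     (\<forall>z. \<forall>a\<in>Hfin. \<forall>b\<in>Hfin. mul (cscale J z a) b = cscale J z (mul a b)) \<and>
     (\<forall>z. \<forall>a\<in>Hfin. \<forall>b\<in>Hfin. mul a (cscale J z b) = cscale J z (mul a b)) \<and>
     \<comment> \<open>commutative\<close>
     (\<forall>a\<in>Hfin. \<forall>b\<in>Hfin. mul a b = mul b a) \<and>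
     \<comment> \<open>unit of norm 1 spanning the invariants\<close>
     one \<in> Hfin \<and> norm one = 1 \<and> (\<forall>a\<in>Hfin. mul one a = a) \<and>
     {v. \<forall>g\<in>SL2. \<pi> g v = v} = range (\<lambda>z. cscale J z one) \<and>
     \<comment> \<open>product rule for g (checked on a real basis of sl_2(R))\<close>
     (\<forall>\<gamma>\<in>{rotm, diagm, nilm}. \<forall>a\<in>Hfin. \<forall>b\<in>Hfin.
        Dgen \<pi> \<gamma> (mul a b) = mul (Dgen \<pi> \<gamma> a) b + mul a (Dgen \<pi> \<gamma> b)) \<and>
     \<comment> \<open>conjugates\<close>
     (\<forall>a\<in>Hfin. \<exists>x\<in>Hfin. \<forall>b\<in>Hfin. \<forall>c\<in>Hfin. ip (mul a b) c = ip b (mul x c)) \<and>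
     \<comment> \<open>crossing symmetry\<close>
     (\<forall>\<alpha>::nat \<Rightarrow> 'h. (\<forall>i<4. \<alpha> i \<in> Hfin) \<longrightarrow> (\<forall>\<sigma>. \<sigma> permutes {..<4} \<longrightarrow>
        ip (mul (\<alpha> 0) (\<alpha> 1)) (mul (conjv ip Hfin mul (\<alpha> 2)) (conjv ip Hfin mul (\<alpha> 3))) =
        ip (mul (\<alpha> (\<sigma> 0)) (\<alpha> (\<sigma> 1)))
           (mul (conjv ip Hfin mul (\<alpha> (\<sigma> 2))) (conjv ip Hfin mul (\<alpha> (\<sigma> 3))))))"

definition lowest_weight_vector ::
  "('h::real_normed_vector \<Rightarrow> 'h) \<Rightarrow> (real^2^2 \<Rightarrow> 'h \<Rightarrow> 'h) \<Rightarrow> 'h \<Rightarrow> bool" where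
  "lowest_weight_vector J \<pi> f \<longleftrightarrow>
     f \<in> smooth_vecs \<pi> \<and> f \<noteq> (0::'h) \<and>
     (\<exists>n::complex. n \<noteq> 0 \<and> opH J \<pi> f = cscale J n f) \<and> opEb J \<pi> f = 0"

definition casimir_proj ::
  "('h::real_normed_vector \<Rightarrow> 'h) \<Rightarrow> ('h \<Rightarrow> 'h \<Rightarrow> complex) \<Rightarrow> (real^2^2 \<Rightarrow> 'h \<Rightarrow> 'h) \<Rightarrow> real \<Rightarrow> 'h \<Rightarrow> 'h" where
  "casimir_proj J ip \<pi> l v =
     oproj ip (closure {w \<in> smooth_vecs \<pi>. casimir J \<pi> w = cscale J (of_real l) w}) v"

text \<open>||h(Delta) v|| < \<infinity>, i.e. sum over lambda of |h lambda|^2 ||P_lambda v||^2 is finite.\<close>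
definition fun_casimir_finite ::
  "('h::real_normed_vector \<Rightarrow> 'h) \<Rightarrow> ('h \<Rightarrow> 'h \<Rightarrow> complex) \<Rightarrow> (real^2^2 \<Rightarrow> 'h \<Rightarrow> 'h) \<Rightarrow> (real \<Rightarrow> complex) \<Rightarrow> 'h \<Rightarrow> bool" where
  "fun_casimir_finite J ip \<pi> h v \<longleftrightarrow>
     (\<lambda>l. (cmod (h l))\<^sup>2 * (norm (casimir_proj J ip \<pi> l v))\<^sup>2) summable_on UNIV"

end

theory Submission
  imports Defs
begin

text \<open>
  Write \<open>F\<close> for the lowering operator, let \<open>f\<close> have weight \<open>k\<close>, and put \<open>G j = E\<^sup>j f\<close> and
  \<open>a j = j (2k + j - 1)\<close>, so that \<open>F (G j) = - a j G (j - 1)\<close>. Let \<open>v j\<close> be the product of \<open>G j\<close> and its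
  conjugate, divided by \<open>a 1 \<cdots> a j\<close>. The product rule gives
  \<open>\<Delta> (v j) = (a j + a (j+1)) v j - a (j+1) v (j+1) - a j v (j-1)\<close>.
  Crossing symmetry turns \<open>\<langle>v i, v j\<rangle>\<close> into a positive multiple of \<open>\<parallel>G i G j\<parallel>\<^sup>2\<close>, and since
  \<open>E ((G j)\<^sup>2) = 2 G j G (j+1)\<close>, the norm of \<open>G j G (j+1)\<close> is determined by those of \<open>(G i)\<^sup>2\<close>, \<open>i \<le> j\<close>.
  Hence \<open>\<langle>v j, v (j+1)\<rangle>\<close> is half of a weighted average of \<open>\<parallel>v i\<parallel>\<^sup>2\<close>, \<open>i \<le> j\<close>. Inserting this in
  the recurrence, and applying Cauchy-Schwarz to \<open>\<langle>\<Delta> (v j), v (j+1)\<rangle> = \<langle>F (v j), F (v (j+1))\<rangle>\<close>, bounds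
  \<open>\<parallel>v j\<parallel>\<close> by a constant times \<open>4\<^sup>j\<close>, with a base that does not depend on \<open>k\<close>. Therefore
  \<open>\<parallel>\<Delta>\<^sup>n (v 0)\<parallel>\<close> is at most a constant times \<open>16\<^sup>n a 1 \<cdots> a n\<close>, which makes the moments of the spectral
  measure of \<open>v 0 = |f|\<^sup>2\<close> small enough for \<open>exp (\<surd>\<Delta> / 8)\<close>.
\<close>

section \<open>Complex Hilbert spaces\<close>

locale complex_hilbert_space =
  fixes J :: "'h::{real_normed_vector,banach} \<Rightarrow> 'h"
    and ip :: "'h \<Rightarrow> 'h \<Rightarrow> complex"
  assumes hilbert: "complex_hilbert J ip"
begin

lemma linear_J: "linear J"
  and J_J [simp]: "J (J v) = - v"
  and ip_add_left: "ip (u + v) w = ip u w + ip v w"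
  and ip_cscale_left: "ip (cscale J z u) w = z * ip u w"
  and ip_commute: "ip v u = cnj (ip u v)"
  and norm_eq_sqrt_ip: "norm v = sqrt (Re (ip v v))"
  using hilbert unfolding complex_hilbert_def by blast+

lemma J_add: "J (u + v) = J u + J v" and J_scaleR: "J (r *\<^sub>R v) = r *\<^sub>R J v"
  and J_diff: "J (u - v) = J u - J v" and J_minus: "J (- v) = - J v" and J_zero [simp]: "J 0 = 0"
  using linear_J by (auto simp: linear_add linear_diff linear_neg linear_0 linear_scale)

lemmas J_simps = J_add J_scaleR J_diff J_minus

lemma cscale_of_real: "cscale J (complex_of_real r) v = r *\<^sub>R v"
  by (simp add: cscale_def)

lemma cscale_add_right: "cscale J z (u + v) = cscale J z u + cscale J z v"
  by (simp add: cscale_def J_simps algebra_simps)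

lemma cscale_cscale: "cscale J z (cscale J w v) = cscale J (z * w) v"
  by (simp add: cscale_def J_simps algebra_simps)

lemma cscale_zero_right [simp]: "cscale J z 0 = 0"
  by (simp add: cscale_def)

lemma cscale_scaleR: "cscale J z (r *\<^sub>R v) = r *\<^sub>R cscale J z v"
  by (simp add: cscale_def J_simps algebra_simps)

lemma ip_scaleR_left: "ip (r *\<^sub>R u) w = of_real r * ip u w"
  using ip_cscale_left[of "of_real r"] by (simp add: cscale_of_real)

lemma ip_add_right: "ip u (v + w) = ip u v + ip u w"
  by (metis ip_commute ip_add_left complex_cnj_add)

lemma ip_cscale_right: "ip u (cscale J z v) = cnj z * ip u v"
  by (metis ip_commute ip_cscale_left complex_cnj_mult)

lemma ip_scaleR_right: "ip u (r *\<^sub>R v) = of_real r * ip u v"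
  using ip_cscale_right[of _ "of_real r"] by (simp add: cscale_of_real)

lemma ip_minus_left: "ip (- u) w = - ip u w" and ip_minus_right: "ip u (- w) = - ip u w"
  using ip_scaleR_left[of "-1"] ip_scaleR_right[of _ "-1"] by simp_all

lemma ip_diff_left: "ip (u - v) w = ip u w - ip v w"
  and ip_diff_right: "ip u (v - w) = ip u v - ip u w"
  using ip_add_left[of u "- v"] ip_add_right[of u v "- w"]
  by (simp_all add: ip_minus_left ip_minus_right)

lemma ip_zero_left [simp]: "ip 0 w = 0" and ip_zero_right [simp]: "ip u 0 = 0"
  using ip_scaleR_left[of 0] ip_scaleR_right[of _ 0] by simp_all

lemmas ip_simps = ip_add_left ip_add_right ip_scaleR_left ip_scaleR_right ip_minus_left
  ip_minus_right ip_diff_left ip_diff_right ip_cscale_left ip_cscale_right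

lemma ip_self: "ip v v = of_real ((norm v)\<^sup>2)"
proof -
  have "Im (ip v v) = 0"
    using ip_commute[of v v] by (metis complex_cnj_cancel_iff Reals_cnj_iff complex_is_Real_iff)
  moreover have "Re (ip v v) \<ge> 0"
    using norm_eq_sqrt_ip[of v] norm_ge_zero[of v] by (metis real_sqrt_ge_0_iff)
  hence "Re (ip v v) = (norm v)\<^sup>2"
    using norm_eq_sqrt_ip[of v] by simp
  ultimately show ?thesis by (simp add: complex_eq_iff)
qed

lemma norm_diff_sq: "(norm (u - v))\<^sup>2 = (norm u)\<^sup>2 - 2 * Re (ip u v) + (norm v)\<^sup>2"
proof -
  have "complex_of_real ((norm (u - v))\<^sup>2) = ip (u - v) (u - v)"
    by (simp only: ip_self)
  also have "\<dots> = ip u u - ip u v - cnj (ip u v) + ip v v"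
    by (simp add: ip_simps ip_commute[of v u])
  finally show ?thesis
    unfolding ip_self complex_eq_iff by simp
qed

lemma norm_add_sq: "(norm (u + v))\<^sup>2 = (norm u)\<^sup>2 + 2 * Re (ip u v) + (norm v)\<^sup>2"
  using norm_diff_sq[of u "- v"] by (simp add: ip_simps)

lemma norm_cscale: "norm (cscale J z v) = cmod z * norm v"
proof -
  have "complex_of_real ((norm (cscale J z v))\<^sup>2) = z * cnj z * of_real ((norm v)\<^sup>2)"
    unfolding ip_self[symmetric] by (simp add: ip_simps)
  also have "\<dots> = of_real ((cmod z * norm v)\<^sup>2)"
    by (simp add: complex_norm_square[symmetric] power_mult_distrib)
  finally have "(norm (cscale J z v))\<^sup>2 = (cmod z * norm v)\<^sup>2"
    by (simp only: of_real_eq_iff)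
  thus ?thesis by (simp add: power2_eq_iff_nonneg)
qed

text \<open>Pythagoras after removing from \<open>v\<close> its component along \<open>u\<close>. It
  yields Cauchy-Schwarz and, later, the orthogonality of a minimal residual.\<close>

lemma norm_sub_proj_sq:
  assumes "u \<noteq> 0"
  shows "(norm (v - cscale J (ip v u / of_real ((norm u)\<^sup>2)) u))\<^sup>2
    = (norm v)\<^sup>2 - (cmod (ip v u))\<^sup>2 / (norm u)\<^sup>2"
proof -
  have "ip v (cscale J (ip v u / of_real ((norm u)\<^sup>2)) u)
      = of_real ((cmod (ip v u))\<^sup>2) / of_real ((norm u)\<^sup>2)"
    by (simp add: ip_simps complex_norm_square mult.commute del: of_real_power)
  hence "Re (ip v (cscale J (ip v u / of_real ((norm u)\<^sup>2)) u)) = (cmod (ip v u))\<^sup>2 / (norm u)\<^sup>2"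
    by (metis Re_complex_of_real of_real_divide)
  moreover have "(norm (cscale J (ip v u / of_real ((norm u)\<^sup>2)) u))\<^sup>2 = (cmod (ip v u))\<^sup>2 / (norm u)\<^sup>2"
    using assms by (simp add: norm_cscale norm_divide norm_power norm_mult power2_eq_square)
  ultimately show ?thesis unfolding norm_diff_sq by simp
qed

lemma cauchy_schwarz: "cmod (ip u v) \<le> norm u * norm v"
proof (cases "v = 0")
  case False
  have "0 \<le> (norm u)\<^sup>2 - (cmod (ip u v))\<^sup>2 / (norm v)\<^sup>2"
    by (metis norm_sub_proj_sq[OF False] zero_le_power2)
  hence "(cmod (ip u v))\<^sup>2 \<le> (norm u * norm v)\<^sup>2"
    using False by (simp add: field_simps)
  thus ?thesis by (simp add: power2_le_iff_abs_le)
qed simp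

lemma bounded_bilinear_ip: "bounded_bilinear ip"
proof
  show "\<exists>K. \<forall>a b. norm (ip a b) \<le> norm a * norm b * K"
    by (rule exI[of _ 1]) (simp add: cauchy_schwarz)
qed (simp_all add: ip_simps scaleR_conv_of_real)

lemma bounded_linear_cscale: "bounded_linear (cscale J z)"
  by (rule bounded_linear_intro[of _ "cmod z"])
    (simp_all add: cscale_add_right cscale_scaleR norm_cscale mult.commute)

lemma csubspace_scaleR: "csubspace J M \<Longrightarrow> v \<in> M \<Longrightarrow> r *\<^sub>R v \<in> M"
  unfolding csubspace_def by (metis cscale_of_real)

lemma csubspace_diff: "csubspace J M \<Longrightarrow> u \<in> M \<Longrightarrow> v \<in> M \<Longrightarrow> u - v \<in> M"
  using csubspace_scaleR[of M v "-1"] unfolding csubspace_def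
  by (metis diff_conv_add_uminus scaleR_minus1_left)

text \<open>A sequence in \<open>M\<close> minimising the distance to \<open>v\<close> is Cauchy by
  the parallelogram law. The residual at its limit is orthogonal to \<open>M\<close>, since removing
  a component along some \<open>u\<close> in \<open>M\<close> would shorten it.\<close>

theorem orthogonal_projection_exists:
  assumes M: "closed M" "csubspace J M"
  shows "\<exists>m\<in>M. \<forall>u\<in>M. ip (v - m) u = 0"
proof -
  have M0: "0 \<in> M" and Madd: "\<And>u w. u \<in> M \<Longrightarrow> w \<in> M \<Longrightarrow> u + w \<in> M"
    and Mcs: "\<And>z u. u \<in> M \<Longrightarrow> cscale J z u \<in> M"
    using M(2) unfolding csubspace_def by auto
  define D where "D = (\<lambda>m. (norm (v - m))\<^sup>2) ` M"
  define d where "d = Inf D"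
  have bdd: "bdd_below D" unfolding D_def by (rule bdd_belowI[of _ 0]) auto
  have d_le: "d \<le> (norm (v - m))\<^sup>2" if "m \<in> M" for m
    unfolding d_def by (rule cInf_lower[OF _ bdd]) (use that D_def in auto)
  have "\<exists>m\<in>M. (norm (v - m))\<^sup>2 < d + 1 / real (Suc n)" for n
  proof -
    have "Inf D < d + 1 / real (Suc n)" unfolding d_def by simp
    moreover have "D \<noteq> {}" unfolding D_def using M0 by auto
    ultimately obtain x where "x \<in> D" "x < d + 1 / real (Suc n)" by (meson cInf_lessD)
    thus ?thesis unfolding D_def by auto
  qed
  then obtain m where mM: "\<And>n. m n \<in> M" and m: "\<And>n. (norm (v - m n))\<^sup>2 < d + 1 / real (Suc n)"
    by metis
  \<comment> \<open>Parallelogram law for \<open>v - m p\<close> and \<open>v - m q\<close>: half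
    their sum is \<open>v\<close> minus a point of \<open>M\<close>, so its squared norm is at least
    \<open>d\<close>, which leaves at most \<open>4 / real (Suc N)\<close> for the
    difference.\<close>
  have close: "(norm (m p - m q))\<^sup>2 \<le> 4 / real (Suc N)" if "p \<ge> N" "q \<ge> N" for p q N
  proof -
    have le: "(norm (v - m n))\<^sup>2 \<le> d + 1 / real (Suc N)" if "n \<ge> N" for n
      using m[of n] that by (smt (verit) frac_le of_nat_0_less_iff of_nat_le_iff Suc_le_mono zero_less_Suc)
    have mid: "d \<le> (norm (v - (1/2) *\<^sub>R (m p + m q)))\<^sup>2"
      by (intro d_le csubspace_scaleR[OF M(2)] Madd mM)
    have "v - (1/2) *\<^sub>R (m p + m q) = (1/2) *\<^sub>R ((v - m p) + (v - m q))"
      by (simp add: algebra_simps scaleR_2[symmetric])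
    hence "(norm (v - (1/2) *\<^sub>R (m p + m q)))\<^sup>2 = (norm ((v - m p) + (v - m q)))\<^sup>2 / 4"
      by (simp add: power_divide)
    moreover have "(norm ((v - m p) - (v - m q)))\<^sup>2 = (norm (m p - m q))\<^sup>2"
      by (simp add: norm_minus_commute)
    ultimately show ?thesis
      using mid le[OF that(1)] le[OF that(2)] norm_add_sq[of "v - m p" "v - m q"]
        norm_diff_sq[of "v - m p" "v - m q"] by simp
  qed
  have "Cauchy m"
  proof (rule CauchyI)
    fix e :: real assume e: "0 < e"
    then obtain N where N: "4 / e\<^sup>2 < real N" using reals_Archimedean2 by blast
    have "4 / real (Suc N) < e\<^sup>2"
      using N e by (simp add: field_simps) (smt (verit) mult_nonneg_nonneg zero_le_power2)
    hence "norm (m p - m q) < e" if "p \<ge> N" "q \<ge> N" for p q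
      using close[OF that] e by (smt (verit) power_mono norm_ge_zero)
    thus "\<exists>M. \<forall>p\<ge>M. \<forall>n\<ge>M. norm (m p - m n) < e" by blast
  qed
  then obtain l where l: "m \<longlonglongrightarrow> l" using Cauchy_convergent convergent_def by blast
  have lM: "l \<in> M" using closed_sequentially[OF M(1)] mM l by blast
  have "(norm (v - l))\<^sup>2 \<le> d"
  proof (rule LIMSEQ_le)
    show "(\<lambda>n. (norm (v - m n))\<^sup>2) \<longlonglongrightarrow> (norm (v - l))\<^sup>2" by (intro tendsto_intros l)
    show "(\<lambda>n. d + 1 / real (Suc n)) \<longlonglongrightarrow> d"
      using tendsto_add[OF tendsto_const[of d] LIMSEQ_inverse_real_of_nat]
      by (simp add: inverse_eq_divide)
  qed (use m less_imp_le in blast)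
  hence min: "(norm (v - l))\<^sup>2 \<le> (norm (v - u))\<^sup>2" if "u \<in> M" for u
    using d_le[OF that] by linarith
  have "ip (v - l) u = 0" if u: "u \<in> M" for u
  proof (cases "u = 0")
    case False
    let ?t = "ip (v - l) u / of_real ((norm u)\<^sup>2)"
    have "(norm (v - l))\<^sup>2 \<le> (norm (v - l - cscale J ?t u))\<^sup>2"
      using min[OF Madd[OF lM Mcs[OF u]], of ?t] by (simp add: algebra_simps)
    hence "(cmod (ip (v - l) u))\<^sup>2 / (norm u)\<^sup>2 \<le> 0"
      unfolding norm_sub_proj_sq[OF False] by simp
    thus ?thesis using False by (simp add: divide_le_0_iff)
  qed simp
  thus ?thesis using lM by blast
qed

lemma oproj:
  assumes M: "closed M" "csubspace J M"
  shows oproj_in: "oproj ip M v \<in> M" and oproj_orth: "u \<in> M \<Longrightarrow> ip (v - oproj ip M v) u = 0"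
proof -
  have "\<exists>!m. m \<in> M \<and> (\<forall>u\<in>M. ip (v - m) u = 0)"
  proof (rule ex_ex1I)
    show "\<exists>m. m \<in> M \<and> (\<forall>u\<in>M. ip (v - m) u = 0)"
      using orthogonal_projection_exists[OF M] by blast
    fix m n
    assume m: "m \<in> M \<and> (\<forall>u\<in>M. ip (v - m) u = 0)" and n: "n \<in> M \<and> (\<forall>u\<in>M. ip (v - n) u = 0)"
    hence "m - n \<in> M" using csubspace_diff[OF M(2)] by blast
    hence "ip (m - n) (m - n) = 0"
      using m n by (simp add: ip_simps)
    thus "m = n" by (simp add: ip_self)
  qed
  from theI'[OF this, folded oproj_def]
  show "oproj ip M v \<in> M" and "u \<in> M \<Longrightarrow> ip (v - oproj ip M v) u = 0" by auto
qed

text \<open>The sum \<open>s\<close> of the projections satisfies \<open>ip v s = ip s s\<close>,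
  both being the left-hand side, so the claim is the positivity of the squared norm of
  \<open>v - s\<close>.\<close>

lemma bessel_projections:
  assumes L: "finite L" and M: "\<And>l. l \<in> L \<Longrightarrow> closed (M l)" "\<And>l. l \<in> L \<Longrightarrow> csubspace J (M l)"
    and orth: "\<And>l l' u w. l \<in> L \<Longrightarrow> l' \<in> L \<Longrightarrow> l \<noteq> l' \<Longrightarrow> u \<in> M l \<Longrightarrow> w \<in> M l' \<Longrightarrow> ip u w = 0"
  shows "(\<Sum>l\<in>L. (norm (oproj ip (M l) v))\<^sup>2) \<le> (norm v)\<^sup>2"
proof -
  define P where "P l = oproj ip (M l) v" for l
  define s where "s = sum P L"
  have PM: "P l \<in> M l" if "l \<in> L" for l unfolding P_def using oproj_in M that by blast
  have ipP: "ip v (P l) = of_real ((norm (P l))\<^sup>2)" if "l \<in> L" for l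
    using oproj_orth[OF M(1)[OF that] M(2)[OF that] PM[OF that], of v]
    by (simp add: P_def ip_simps ip_self)
  interpret I: bounded_bilinear ip by (rule bounded_bilinear_ip)
  have vs: "ip v s = of_real (\<Sum>l\<in>L. (norm (P l))\<^sup>2)"
    unfolding s_def I.sum_right by (simp add: ipP)
  have "ip s s = (\<Sum>l\<in>L. \<Sum>l'\<in>L. ip (P l) (P l'))"
    unfolding s_def I.sum_left I.sum_right by (rule sum.swap)
  also have "\<dots> = (\<Sum>l\<in>L. \<Sum>l'\<in>L. if l' = l then ip (P l) (P l) else 0)"
    by (intro sum.cong refl) (auto intro: orth PM)
  also have "\<dots> = of_real (\<Sum>l\<in>L. (norm (P l))\<^sup>2)"
    using L by (simp add: sum.delta ip_self)
  finally have ss: "(norm s)\<^sup>2 = (\<Sum>l\<in>L. (norm (P l))\<^sup>2)"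
    unfolding ip_self of_real_eq_iff .
  have "0 \<le> (norm (v - s))\<^sup>2" by simp
  thus ?thesis unfolding norm_diff_sq vs ss P_def[symmetric] by simp
qed

end

section \<open>Curves in SL(2,R)\<close>

text \<open>The adjugate, which is the inverse on \<open>SL2\<close>; its entries are linear in
  those of \<open>h\<close>, so curves of conjugates can be differentiated entrywise.\<close>

definition adj2 :: "real^2^2 \<Rightarrow> real^2^2" where
  "adj2 h = vector [vector [h $ 2 $ 2, - h $ 1 $ 2], vector [- h $ 2 $ 1, h $ 1 $ 1]]"

lemma mat2_eq_iff:
  "(A :: real^2^2) = B \<longleftrightarrow> A$1$1 = B$1$1 \<and> A$1$2 = B$1$2 \<and> A$2$1 = B$2$1 \<and> A$2$2 = B$2$2"
  by (auto simp: vec_eq_iff forall_2)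

lemma mat2_entries:
  "(vector [vector [a, b], vector [c, d]] :: real^2^2) $ 1 $ 1 = a"
  "(vector [vector [a, b], vector [c, d]] :: real^2^2) $ 1 $ 2 = b"
  "(vector [vector [a, b], vector [c, d]] :: real^2^2) $ 2 $ 1 = c"
  "(vector [vector [a, b], vector [c, d]] :: real^2^2) $ 2 $ 2 = d"
  "(mat 1 :: real^2^2) $ 1 $ 1 = 1" "(mat 1 :: real^2^2) $ 1 $ 2 = 0"
  "(mat 1 :: real^2^2) $ 2 $ 1 = 0" "(mat 1 :: real^2^2) $ 2 $ 2 = 1"
  by (simp_all add: mat_def)

lemma mat2_mult_entry: "((A :: real^2^2) ** B) $ i $ j = A$i$1 * B$1$j + A$i$2 * B$2$j"
  by (simp add: matrix_matrix_mult_def sum_2)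

lemma SL2_iff: "g \<in> SL2 \<longleftrightarrow> g$1$1 * g$2$2 - g$1$2 * g$2$1 = 1"
  by (simp add: SL2_def det_2)

lemma SL2_mult: "g \<in> SL2 \<Longrightarrow> h \<in> SL2 \<Longrightarrow> g ** h \<in> SL2"
  by (simp add: SL2_def det_mul)

lemma SL2_adj2: "h \<in> SL2 \<Longrightarrow> adj2 h \<in> SL2"
  by (simp add: SL2_iff adj2_def mat2_entries algebra_simps)

lemma adj2_mult: "h \<in> SL2 \<Longrightarrow> h ** adj2 h = mat 1" "h \<in> SL2 \<Longrightarrow> adj2 h ** h = mat 1"
  by (simp_all add: mat2_eq_iff mat2_mult_entry mat2_entries adj2_def SL2_iff algebra_simps)

lemma adj2_adj2 [simp]: "adj2 (adj2 h) = h"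
  by (simp add: mat2_eq_iff mat2_entries adj2_def)

lemma mat_1_SL2: "mat 1 \<in> SL2"
  by (simp add: SL2_def)

lemma basis_SL2: "rotm t \<in> SL2" "diagm t \<in> SL2" "nilm t \<in> SL2"
  by (simp_all add: SL2_iff rotm_def diagm_def nilm_def mat2_entries exp_minus)

text \<open>The curve has tangent \<open>[[x, y], [z, -x]]\<close> at the identity.\<close>
definition tangent_curve :: "(real \<Rightarrow> real^2^2) \<Rightarrow> real \<Rightarrow> real \<Rightarrow> real \<Rightarrow> bool" where
  "tangent_curve \<gamma> x y z \<longleftrightarrow> (\<forall>s. \<gamma> s \<in> SL2) \<and> \<gamma> 0 = mat 1 \<and>
     ((\<lambda>s. \<gamma> s $ 1 $ 1) has_real_derivative x) (at 0) \<and>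
     ((\<lambda>s. \<gamma> s $ 1 $ 2) has_real_derivative y) (at 0) \<and>
     ((\<lambda>s. \<gamma> s $ 2 $ 1) has_real_derivative z) (at 0) \<and>
     ((\<lambda>s. \<gamma> s $ 2 $ 2) has_real_derivative - x) (at 0)"

lemma tangent_curve_basis:
  "tangent_curve rotm 0 1 (- 1)" "tangent_curve diagm 1 0 0" "tangent_curve nilm 0 1 0"
  unfolding tangent_curve_def
  by (simp_all add: basis_SL2) (auto simp: mat2_eq_iff rotm_def diagm_def nilm_def mat2_entries
      intro!: derivative_eq_intros)

lemma tangent_curve_continuous:
  assumes "tangent_curve \<gamma> x y z"
  shows "(\<gamma> \<longlongrightarrow> mat 1) (at 0)"
proof -
  have c: "isCont (\<lambda>s. \<gamma> s $ 1 $ 1) 0" "isCont (\<lambda>s. \<gamma> s $ 1 $ 2) 0"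
    "isCont (\<lambda>s. \<gamma> s $ 2 $ 1) 0" "isCont (\<lambda>s. \<gamma> s $ 2 $ 2) 0" and "\<gamma> 0 = mat 1"
    using assms unfolding tangent_curve_def by (auto dest: DERIV_isCont)
  hence "\<forall>i j. ((\<lambda>s. \<gamma> s $ i $ j) \<longlongrightarrow> mat 1 $ i $ j) (at 0)"
    unfolding forall_2 by (auto simp: isCont_def)
  thus ?thesis by (intro vec_tendstoI) auto
qed

text \<open>The entries of \<open>h X h\<inverse>\<close> for \<open>X = [[x, y], [z, -x]]\<close>.\<close>
definition Ad1 :: "real^2^2 \<Rightarrow> real \<Rightarrow> real \<Rightarrow> real \<Rightarrow> real" where
  "Ad1 h x y z = (h$1$1 * x + h$1$2 * z) * h$2$2 - (h$1$1 * y - h$1$2 * x) * h$2$1"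
definition Ad2 :: "real^2^2 \<Rightarrow> real \<Rightarrow> real \<Rightarrow> real \<Rightarrow> real" where
  "Ad2 h x y z = (h$1$1 * y - h$1$2 * x) * h$1$1 - (h$1$1 * x + h$1$2 * z) * h$1$2"
definition Ad3 :: "real^2^2 \<Rightarrow> real \<Rightarrow> real \<Rightarrow> real \<Rightarrow> real" where
  "Ad3 h x y z = (h$2$1 * x + h$2$2 * z) * h$2$2 - (h$2$1 * y - h$2$2 * x) * h$2$1"

lemma tangent_curve_Ad:
  assumes "tangent_curve \<gamma> x y z" and h: "h \<in> SL2"
  shows "tangent_curve (\<lambda>s. h ** \<gamma> s ** adj2 h) (Ad1 h x y z) (Ad2 h x y z) (Ad3 h x y z)"
proof -
  have D: "((\<lambda>s. \<gamma> s $ 1 $ 1) has_real_derivative x) (at 0)"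
    "((\<lambda>s. \<gamma> s $ 1 $ 2) has_real_derivative y) (at 0)"
    "((\<lambda>s. \<gamma> s $ 2 $ 1) has_real_derivative z) (at 0)"
    "((\<lambda>s. \<gamma> s $ 2 $ 2) has_real_derivative - x) (at 0)"
    using assms(1) unfolding tangent_curve_def by auto
  have E: "(h ** g ** adj2 h) $ 1 $ 1 = (h$1$1 * g$1$1 + h$1$2 * g$2$1) * h$2$2 - (h$1$1 * g$1$2 + h$1$2 * g$2$2) * h$2$1"
    "(h ** g ** adj2 h) $ 1 $ 2 = (h$1$1 * g$1$2 + h$1$2 * g$2$2) * h$1$1 - (h$1$1 * g$1$1 + h$1$2 * g$2$1) * h$1$2"
    "(h ** g ** adj2 h) $ 2 $ 1 = (h$2$1 * g$1$1 + h$2$2 * g$2$1) * h$2$2 - (h$2$1 * g$1$2 + h$2$2 * g$2$2) * h$2$1"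
    "(h ** g ** adj2 h) $ 2 $ 2 = (h$2$1 * g$1$2 + h$2$2 * g$2$2) * h$1$1 - (h$2$1 * g$1$1 + h$2$2 * g$2$1) * h$1$2"
    for g :: "real^2^2"
    by (simp_all add: mat2_mult_entry adj2_def mat2_entries algebra_simps)
  show ?thesis
    unfolding tangent_curve_def Ad1_def Ad2_def Ad3_def
  proof (intro conjI allI)
    show "h ** \<gamma> s ** adj2 h \<in> SL2" for s
      using assms unfolding tangent_curve_def by (intro SL2_mult SL2_adj2) auto
    show "h ** \<gamma> 0 ** adj2 h = mat 1"
      using assms unfolding tangent_curve_def by (simp add: adj2_mult)
  qed (unfold E, ((rule derivative_eq_intros D refl)+, simp add: algebra_simps)+)
qed

text \<open>The bottom row fixes the rotation (its direction) and the diagonal factor (its length);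
  the determinant condition then gives the unipotent factor. Positivity of the lower right entry
  puts the angle on the branch of \<open>arctan\<close>.\<close>

lemma iwasawa_decomposition:
  assumes g: "g \<in> SL2" and d: "g$2$2 > 0"
  shows "g = nilm ((g$1$1 * g$2$1 + g$1$2 * g$2$2) / ((g$2$1)\<^sup>2 + (g$2$2)\<^sup>2))
    ** diagm (- ln ((g$2$1)\<^sup>2 + (g$2$2)\<^sup>2) / 2) ** rotm (- arctan (g$2$1 / g$2$2))"
proof -
  define a b c e where ab: "a = g$1$1" "b = g$1$2" "c = g$2$1" "e = g$2$2"
  have det: "a * e - b * c = 1" and e: "e > 0" using g d by (simp_all add: SL2_iff ab)
  define N where "N = c\<^sup>2 + e\<^sup>2"
  have N: "N > 0" unfolding N_def using e by (intro add_nonneg_pos) auto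
  have "1 + (c / e)\<^sup>2 = N / e\<^sup>2"
    unfolding N_def using e by (simp add: power_divide add_divide_distrib)
  hence "sqrt (1 + (c / e)\<^sup>2) = sqrt N / e" using e by (simp add: real_sqrt_divide)
  hence co: "cos (arctan (c / e)) = e / sqrt N" and si: "sin (arctan (c / e)) = c / sqrt N"
    unfolding cos_arctan sin_arctan using e by simp_all
  have ex: "exp (ln N / 2) = sqrt N"
    using N by (simp add: ln_sqrt[symmetric])
  have ex': "exp (- (ln N / 2)) = 1 / sqrt N"
    unfolding exp_minus ex by (simp add: inverse_eq_divide)
  have s: "sqrt N * sqrt N = N" using N by simp
  have "a * N - ((a * c + b * e) * c + e) = e * (a * e - b * c) - e"
    "b * N - ((a * c + b * e) * e - c) = c - c * (a * e - b * c)"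
    by (simp_all add: N_def power2_eq_square algebra_simps)
  hence 1: "a * N = (a * c + b * e) * c + e" "b * N = (a * c + b * e) * e - c"
    unfolding det by simp_all
  have "(a * c + b * e) / N * c + e / N = a * N / N" "(a * c + b * e) / N * e - c / N = b * N / N"
    unfolding 1 by (simp_all add: add_divide_distrib diff_divide_distrib distrib_right)
  hence "(a * c + b * e) / N * c + e / N = a" "(a * c + b * e) / N * e - c / N = b"
    using N by simp_all
  thus ?thesis
    unfolding mat2_eq_iff ab[symmetric] N_def[symmetric]
    using N by (simp add: mat2_mult_entry nilm_def diagm_def rotm_def mat2_entries co si ex ex' s)
qed

lemma has_vector_derivative_at_0_iff:
  "(f has_vector_derivative D) (at 0) \<longleftrightarrow> ((\<lambda>s::real. (f s - f 0) /\<^sub>R s) \<longlongrightarrow> D) (at 0)"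
proof -
  have "(f has_vector_derivative D) (at 0) \<longleftrightarrow> ((\<lambda>s. norm (f s - f 0 - s *\<^sub>R D) / \<bar>s\<bar>) \<longlongrightarrow> 0) (at 0)"
    unfolding has_vector_derivative_def has_derivative_at
    by (simp add: bounded_linear_scaleR_left)
  also have "\<dots> \<longleftrightarrow> ((\<lambda>s. norm ((f s - f 0) /\<^sub>R s - D)) \<longlongrightarrow> 0) (at 0)"
  proof (rule filterlim_cong[OF refl refl])
    have "norm (f s - f 0 - s *\<^sub>R D) / \<bar>s\<bar> = norm ((f s - f 0) /\<^sub>R s - D)" if "s \<noteq> 0" for s
    proof -
      have "(f s - f 0) /\<^sub>R s - D = (f s - f 0 - s *\<^sub>R D) /\<^sub>R s"
        using that by (simp add: scaleR_diff_right)
      thus ?thesis by (simp add: divide_inverse mult.commute)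
    qed
    thus "\<forall>\<^sub>F s in at 0. norm (f s - f 0 - s *\<^sub>R D) / \<bar>s\<bar> = norm ((f s - f 0) /\<^sub>R s - D)"
      by (simp add: eventually_at_filter)
  qed
  also have "\<dots> \<longleftrightarrow> ((\<lambda>s. (f s - f 0) /\<^sub>R s) \<longlongrightarrow> D) (at 0)"
    by (simp add: tendsto_norm_zero_iff LIM_zero_iff)
  finally show ?thesis .
qed

section \<open>Smooth vectors\<close>

locale unitary_representation =
  fixes J :: "'h::{real_normed_vector,banach} \<Rightarrow> 'h"
    and ip :: "'h \<Rightarrow> 'h \<Rightarrow> complex"
    and \<pi> :: "real^2^2 \<Rightarrow> 'h \<Rightarrow> 'h"
  assumes unitary: "unitary_rep J ip \<pi>"
begin

sublocale complex_hilbert_space J ip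
  using unitary unfolding unitary_rep_def by unfold_locales auto

lemma \<pi>_1 [simp]: "\<pi> (mat 1) v = v"
  and \<pi>_mult: "g \<in> SL2 \<Longrightarrow> h \<in> SL2 \<Longrightarrow> \<pi> (g ** h) v = \<pi> g (\<pi> h v)"
  and \<pi>_add: "g \<in> SL2 \<Longrightarrow> \<pi> g (u + v) = \<pi> g u + \<pi> g v"
  and \<pi>_cscale: "g \<in> SL2 \<Longrightarrow> \<pi> g (cscale J z v) = cscale J z (\<pi> g v)"
  and \<pi>_ip: "g \<in> SL2 \<Longrightarrow> ip (\<pi> g u) (\<pi> g v) = ip u v"
  and \<pi>_continuous: "continuous_on SL2 (\<lambda>g. \<pi> g v)"
  using unitary unfolding unitary_rep_def by auto

lemma \<pi>_scaleR: "g \<in> SL2 \<Longrightarrow> \<pi> g (r *\<^sub>R v) = r *\<^sub>R \<pi> g v"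
  using \<pi>_cscale[of g "of_real r"] by (simp add: cscale_of_real)

lemma \<pi>_norm: "g \<in> SL2 \<Longrightarrow> norm (\<pi> g v) = norm v"
  by (simp add: norm_eq_sqrt_ip \<pi>_ip)

lemma \<pi>_bounded_linear: "g \<in> SL2 \<Longrightarrow> bounded_linear (\<pi> g)"
  by (rule bounded_linear_intro[of _ 1]) (simp_all add: \<pi>_add \<pi>_scaleR \<pi>_norm)

lemma \<pi>_diff: "g \<in> SL2 \<Longrightarrow> \<pi> g (u - v) = \<pi> g u - \<pi> g v"
  using bounded_linear.linear[OF \<pi>_bounded_linear] by (simp add: linear_diff)

lemma \<pi>_tendsto_along_curve:
  assumes "tangent_curve \<gamma> x y z"
  shows "((\<lambda>s. \<pi> (\<gamma> s) v) \<longlongrightarrow> v) (at 0)"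
proof -
  have "((\<lambda>s. \<pi> (\<gamma> s) v) \<longlongrightarrow> \<pi> (mat 1) v) (at 0)"
    by (rule continuous_on_tendsto_compose[OF \<pi>_continuous tangent_curve_continuous[OF assms] mat_1_SL2])
      (use assms in \<open>auto simp: tangent_curve_def\<close>)
  thus ?thesis by simp
qed

text \<open>The difference quotient splits into \<open>\<pi> (h s)\<close> applied to that of
  \<open>u\<close>, plus that of the orbit of the fixed vector \<open>u 0\<close>. In the first term
  unitarity absorbs the error of the quotient and strong continuity handles its limit.\<close>

lemma product_derivative:
  assumes h: "\<And>s. h s \<in> SL2" "h 0 = mat 1" "\<And>v. ((\<lambda>s. \<pi> (h s) v) \<longlongrightarrow> v) (at 0)"
    and u: "(u has_vector_derivative u') (at 0)"
    and w: "((\<lambda>s. \<pi> (h s) (u 0)) has_vector_derivative w') (at 0)"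
  shows "((\<lambda>s. \<pi> (h s) (u s)) has_vector_derivative u' + w') (at 0)"
proof -
  let ?q = "\<lambda>s. (u s - u 0) /\<^sub>R s"
  have q: "(?q \<longlongrightarrow> u') (at 0)" using u has_vector_derivative_at_0_iff by blast
  have "((\<lambda>s. \<pi> (h s) (?q s) - \<pi> (h s) u') \<longlongrightarrow> 0) (at 0)"
  proof (rule tendsto_norm_zero_cancel)
    have "norm (\<pi> (h s) (?q s) - \<pi> (h s) u') = norm (?q s - u')" for s
      by (simp add: \<pi>_diff[OF h(1), symmetric] \<pi>_norm[OF h(1)])
    thus "((\<lambda>s. norm (\<pi> (h s) (?q s) - \<pi> (h s) u')) \<longlongrightarrow> 0) (at 0)"
      using tendsto_norm_zero[OF LIM_zero[OF q]] by simp
  qed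
  from tendsto_add[OF this h(3)[of u']] have 1: "((\<lambda>s. \<pi> (h s) (?q s)) \<longlongrightarrow> u') (at 0)" by simp
  have "((\<lambda>s. (\<pi> (h s) (u 0) - u 0) /\<^sub>R s) \<longlongrightarrow> w') (at 0)"
    using w unfolding has_vector_derivative_at_0_iff by (simp add: h(2))
  from tendsto_add[OF 1 this] show ?thesis
    unfolding has_vector_derivative_at_0_iff
    by (simp add: h(1,2) \<pi>_scaleR \<pi>_diff algebra_simps)
qed

abbreviation "DA \<equiv> Dgen \<pi> diagm"
abbreviation "DN \<equiv> Dgen \<pi> nilm"
abbreviation "DR \<equiv> Dgen \<pi> rotm"
abbreviation "smooth \<equiv> smooth_vecs \<pi>"

text \<open>Smooth vectors form a greatest fixed point, so every closure property below is proved by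
  exhibiting a set stable under the three derivations.\<close>

lemma smooth_vecs_coinduct:
  assumes "v \<in> S" and "\<And>v \<gamma>. v \<in> S \<Longrightarrow> \<gamma> \<in> {rotm, diagm, nilm} \<Longrightarrow>
    (\<lambda>t. \<pi> (\<gamma> t) v) differentiable (at 0) \<and> Dgen \<pi> \<gamma> v \<in> S"
  shows "v \<in> smooth"
  unfolding smooth_vecs_def using assms by blast

lemma smooth_Dgen:
  assumes "v \<in> smooth" "\<gamma> \<in> {rotm, diagm, nilm}"
  shows smooth_has_derivative: "((\<lambda>t. \<pi> (\<gamma> t) v) has_vector_derivative Dgen \<pi> \<gamma> v) (at 0)"
    and Dgen_smooth: "Dgen \<pi> \<gamma> v \<in> smooth"
proof -
  obtain S where S: "v \<in> S" "\<forall>v\<in>S. \<forall>\<gamma>\<in>{rotm, diagm, nilm}.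
        (\<lambda>t. \<pi> (\<gamma> t) v) differentiable (at 0) \<and> Dgen \<pi> \<gamma> v \<in> S"
    using assms(1) unfolding smooth_vecs_def by blast
  show "((\<lambda>t. \<pi> (\<gamma> t) v) has_vector_derivative Dgen \<pi> \<gamma> v) (at 0)"
    using S assms(2) unfolding Dgen_def vector_derivative_works[symmetric] by blast
  show "Dgen \<pi> \<gamma> v \<in> smooth"
    by (rule smooth_vecs_coinduct[of _ S]) (use S assms(2) in auto)
qed

lemma Dgen_eqI: "((\<lambda>t. \<pi> (\<gamma> t) v) has_vector_derivative D) (at 0) \<Longrightarrow> Dgen \<pi> \<gamma> v = D"
  unfolding Dgen_def by (rule vector_derivative_at)

lemma basis_tangent_curve:
  assumes "\<gamma> \<in> {rotm, diagm, nilm}"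
  obtains x y z where "tangent_curve \<gamma> x y z"
  using assms tangent_curve_basis by blast

lemma basis_in_SL2: "\<gamma> \<in> {rotm, diagm, nilm} \<Longrightarrow> \<gamma> t \<in> SL2"
  using basis_SL2 by auto

lemma smooth_add_derivative:
  assumes "u \<in> smooth" "v \<in> smooth" "\<gamma> \<in> {rotm, diagm, nilm}"
  shows "((\<lambda>t. \<pi> (\<gamma> t) (u + v)) has_vector_derivative Dgen \<pi> \<gamma> u + Dgen \<pi> \<gamma> v) (at 0)"
  using has_vector_derivative_add[OF smooth_has_derivative[OF assms(1,3)] smooth_has_derivative[OF assms(2,3)]]
  by (simp add: \<pi>_add basis_in_SL2[OF assms(3)])

lemma smooth_cscale_derivative:
  assumes "v \<in> smooth" "\<gamma> \<in> {rotm, diagm, nilm}"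
  shows "((\<lambda>t. \<pi> (\<gamma> t) (cscale J z v)) has_vector_derivative cscale J z (Dgen \<pi> \<gamma> v)) (at 0)"
  using bounded_linear.has_vector_derivative[OF bounded_linear_cscale smooth_has_derivative[OF assms]]
  by (simp add: \<pi>_cscale basis_in_SL2[OF assms(2)])

lemma smooth_0: "0 \<in> smooth"
proof -
  have D: "((\<lambda>t. \<pi> (\<gamma> t) 0) has_vector_derivative 0) (at 0)" if "\<gamma> \<in> {rotm, diagm, nilm}" for \<gamma>
  proof -
    have "\<pi> (\<gamma> t) 0 = 0" for t using \<pi>_diff[OF basis_in_SL2[OF that, of t], of 0 0] by simp
    thus ?thesis by simp
  qed
  show ?thesis
    by (rule smooth_vecs_coinduct[of _ "{0}"])
      (use differentiableI_vector[OF D] Dgen_eqI[OF D] in auto)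
qed

lemma smooth_add:
  assumes "u \<in> smooth" "v \<in> smooth" shows "u + v \<in> smooth"
proof (rule smooth_vecs_coinduct[of _ "{u + v | u v. u \<in> smooth \<and> v \<in> smooth}"])
  fix w \<gamma> assume "w \<in> {u + v | u v. u \<in> smooth \<and> v \<in> smooth}" and \<gamma>: "\<gamma> \<in> {rotm, diagm, nilm}"
  then obtain u v where w: "w = u + v" "u \<in> smooth" "v \<in> smooth" by blast
  note D = smooth_add_derivative[OF w(2,3) \<gamma>, folded w(1)]
  show "(\<lambda>t. \<pi> (\<gamma> t) w) differentiable at 0 \<and> Dgen \<pi> \<gamma> w \<in> {u + v | u v. u \<in> smooth \<and> v \<in> smooth}"
    using differentiableI_vector[OF D] Dgen_eqI[OF D] Dgen_smooth[OF _ \<gamma>] w by auto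
qed (use assms in blast)

lemma smooth_cscale:
  assumes "v \<in> smooth" shows "cscale J z v \<in> smooth"
proof (rule smooth_vecs_coinduct[of _ "cscale J z ` smooth"])
  fix w \<gamma> assume "w \<in> cscale J z ` smooth" and \<gamma>: "\<gamma> \<in> {rotm, diagm, nilm}"
  then obtain v where w: "w = cscale J z v" "v \<in> smooth" by blast
  note D = smooth_cscale_derivative[OF w(2) \<gamma>, of z, folded w(1)]
  show "(\<lambda>t. \<pi> (\<gamma> t) w) differentiable at 0 \<and> Dgen \<pi> \<gamma> w \<in> cscale J z ` smooth"
    using differentiableI_vector[OF D] Dgen_eqI[OF D] Dgen_smooth[OF w(2) \<gamma>] by auto
qed (use assms in blast)

lemma smooth_scaleR: "v \<in> smooth \<Longrightarrow> r *\<^sub>R v \<in> smooth"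
  using smooth_cscale[of v "of_real r"] by (simp add: cscale_of_real)

lemma smooth_diff: "u \<in> smooth \<Longrightarrow> v \<in> smooth \<Longrightarrow> u - v \<in> smooth"
  using smooth_add[of u "(-1) *\<^sub>R v"] smooth_scaleR[of v "-1"] by simp

lemma smooth_uminus: "v \<in> smooth \<Longrightarrow> - v \<in> smooth"
  using smooth_scaleR[of v "-1"] by simp

lemma smooth_D: "v \<in> smooth \<Longrightarrow> DA v \<in> smooth" "v \<in> smooth \<Longrightarrow> DN v \<in> smooth"
  "v \<in> smooth \<Longrightarrow> DR v \<in> smooth"
  by (simp_all add: Dgen_smooth)

lemmas smooth_intros = smooth_0 smooth_add smooth_cscale smooth_scaleR smooth_diff smooth_uminus smooth_D

lemma Dgen_add:
  assumes "\<gamma> \<in> {rotm, diagm, nilm}" "u \<in> smooth" "v \<in> smooth"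
  shows "Dgen \<pi> \<gamma> (u + v) = Dgen \<pi> \<gamma> u + Dgen \<pi> \<gamma> v"
  using smooth_add_derivative assms Dgen_eqI by blast

lemma Dgen_cscale:
  assumes "\<gamma> \<in> {rotm, diagm, nilm}" "v \<in> smooth"
  shows "Dgen \<pi> \<gamma> (cscale J z v) = cscale J z (Dgen \<pi> \<gamma> v)"
  using smooth_cscale_derivative assms Dgen_eqI by blast

lemma Dgen_scaleR:
  assumes "\<gamma> \<in> {rotm, diagm, nilm}" "v \<in> smooth"
  shows "Dgen \<pi> \<gamma> (r *\<^sub>R v) = r *\<^sub>R Dgen \<pi> \<gamma> v"
  using Dgen_cscale[OF assms, of "of_real r"] by (simp add: cscale_of_real)

text \<open>By unitarity the inner product of the two orbits is constant, and its derivative at 0 is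
  the sum of the two terms.\<close>

lemma Dgen_skew:
  assumes \<gamma>: "\<gamma> \<in> {rotm, diagm, nilm}" and u: "u \<in> smooth" and v: "v \<in> smooth"
  shows "ip (Dgen \<pi> \<gamma> u) v = - ip u (Dgen \<pi> \<gamma> v)"
proof -
  obtain x y z where c: "tangent_curve \<gamma> x y z" using basis_tangent_curve[OF \<gamma>] .
  have [simp]: "\<gamma> 0 = mat 1" using c by (simp add: tangent_curve_def)
  have "((\<lambda>t. ip (\<pi> (\<gamma> t) u) (\<pi> (\<gamma> t) v)) has_vector_derivative
      ip (\<pi> (\<gamma> 0) u) (Dgen \<pi> \<gamma> v) + ip (Dgen \<pi> \<gamma> u) (\<pi> (\<gamma> 0) v)) (at 0)"
    by (rule bounded_bilinear.has_vector_derivative[OF bounded_bilinear_ip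
          smooth_has_derivative[OF u \<gamma>] smooth_has_derivative[OF v \<gamma>]])
  hence "((\<lambda>t. ip u v) has_vector_derivative ip u (Dgen \<pi> \<gamma> v) + ip (Dgen \<pi> \<gamma> u) v) (at 0)"
    by (simp add: \<pi>_ip basis_in_SL2[OF \<gamma>])
  hence "ip u (Dgen \<pi> \<gamma> v) + ip (Dgen \<pi> \<gamma> u) v = 0"
    using has_vector_derivative_const vector_derivative_unique_at by blast
  thus ?thesis by (simp add: add_eq_0_iff add.commute)
qed

text \<open>The derivative along the element \<open>[[x, y], [z, -x]]\<close> of the Lie algebra.\<close>
definition Dlin :: "real \<Rightarrow> real \<Rightarrow> real \<Rightarrow> 'h \<Rightarrow> 'h" where
  "Dlin x y z v = x *\<^sub>R DA v + (y + z) *\<^sub>R DN v - z *\<^sub>R DR v"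

text \<open>In Iwasawa coordinates every curve is a product of the three one-parameter subgroups along
  which a smooth vector is differentiable.\<close>
lemma curve_derivative:
  assumes c: "tangent_curve g x y z" and v: "v \<in> smooth"
  shows "((\<lambda>s. \<pi> (g s) v) has_vector_derivative Dlin x y z v) (at 0)"
proof -
  have gSL: "\<And>s. g s \<in> SL2" and g0: "g 0 = mat 1"
    and D: "((\<lambda>s. g s $ 1 $ 1) has_real_derivative x) (at 0)"
    "((\<lambda>s. g s $ 1 $ 2) has_real_derivative y) (at 0)"
    "((\<lambda>s. g s $ 2 $ 1) has_real_derivative z) (at 0)"
    "((\<lambda>s. g s $ 2 $ 2) has_real_derivative - x) (at 0)"
    using c unfolding tangent_curve_def by auto
  \<comment> \<open>The Iwasawa coordinates of \<open>g s\<close>. Their derivatives at 0 are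
    \<open>y + z\<close>, \<open>x\<close> and \<open>- z\<close>, which are the coefficients in
    \<open>Dlin\<close>.\<close>
  define n where "n s = (g s$1$1 * g s$2$1 + g s$1$2 * g s$2$2) / ((g s$2$1)\<^sup>2 + (g s$2$2)\<^sup>2)" for s
  define a where "a s = - ln ((g s$2$1)\<^sup>2 + (g s$2$2)\<^sup>2) / 2" for s
  define th where "th s = - arctan (g s$2$1 / g s$2$2)" for s
  have n0: "n 0 = 0" and a0: "a 0 = 0" and th0: "th 0 = 0"
    by (simp_all add: n_def a_def th_def g0 mat2_entries)
  have n': "(n has_real_derivative y + z) (at 0)"
    unfolding n_def by (rule derivative_eq_intros D refl | simp add: g0 mat2_entries)+
  have a': "(a has_real_derivative x) (at 0)"
    unfolding a_def by (rule derivative_eq_intros D refl | simp add: g0 mat2_entries)+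
  have th': "(th has_real_derivative - z) (at 0)"
    unfolding th_def by (rule derivative_eq_intros D refl | simp add: g0 mat2_entries)+
  have chain: "((\<lambda>s. \<pi> (\<gamma> (p s)) v) has_vector_derivative p' *\<^sub>R Dgen \<pi> \<gamma> v) (at 0)"
    if "\<gamma> \<in> {rotm, diagm, nilm}" "p 0 = 0" "(p has_real_derivative p') (at 0)" for \<gamma> p p'
    using vector_diff_chain_at[of p p' 0 "\<lambda>t. \<pi> (\<gamma> t) v"] smooth_has_derivative[OF v that(1)] that(2,3)
    by (simp add: has_real_derivative_iff_has_vector_derivative o_def)
  have lim: "((\<lambda>s. \<pi> (\<gamma> (p s)) w) \<longlongrightarrow> w) (at 0)"
    if \<gamma>: "\<gamma> \<in> {rotm, diagm, nilm}" and "p 0 = 0" "(p has_real_derivative p') (at 0)" for \<gamma> p p' w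
  proof -
    obtain x y z where c: "tangent_curve \<gamma> x y z" using basis_tangent_curve[OF \<gamma>] .
    have "isCont (\<lambda>t. \<pi> (\<gamma> t) w) 0"
      using \<pi>_tendsto_along_curve[OF c, of w] c by (simp add: isCont_def tangent_curve_def)
    moreover have "isCont p 0" using that DERIV_isCont by blast
    ultimately have "isCont (\<lambda>s. \<pi> (\<gamma> (p s)) w) 0" using isCont_o2[of 0 p "\<lambda>t. \<pi> (\<gamma> t) w"] that by simp
    thus ?thesis using c that by (simp add: isCont_def tangent_curve_def)
  qed
  have b0: "rotm 0 = mat 1" "diagm 0 = mat 1" "nilm 0 = mat 1"
    using tangent_curve_basis unfolding tangent_curve_def by auto
  have 1: "((\<lambda>s. \<pi> (diagm (a s)) (\<pi> (rotm (th s)) v)) has_vector_derivative - z *\<^sub>R DR v + x *\<^sub>R DA v) (at 0)"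
    by (rule product_derivative)
      (use lim[OF _ a0 a', of diagm] chain[OF _ th0 th', of rotm] chain[OF _ a0 a', of diagm]
        in \<open>simp_all add: basis_SL2 a0 th0 b0\<close>)
  have 2: "((\<lambda>s. \<pi> (nilm (n s)) (\<pi> (diagm (a s)) (\<pi> (rotm (th s)) v))) has_vector_derivative
      (- z *\<^sub>R DR v + x *\<^sub>R DA v) + (y + z) *\<^sub>R DN v) (at 0)"
    by (rule product_derivative[OF _ _ _ 1])
      (use lim[OF _ n0 n', of nilm] chain[OF _ n0 n', of nilm]
        in \<open>simp_all add: basis_SL2 a0 th0 n0 b0\<close>)
  \<comment> \<open>The decomposition requires a positive lower right entry. That entry is 1 at
    \<open>s = 0\<close>, so it is positive nearby, and the derivative sees only a neighbourhood of
    0.\<close>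
  have "isCont (\<lambda>s. g s $ 2 $ 2) 0" using D(4) DERIV_isCont by blast
  hence "((\<lambda>s. g s $ 2 $ 2) \<longlongrightarrow> 1) (at 0)" by (simp add: isCont_def g0 mat2_entries)
  hence "\<forall>\<^sub>F s in at 0. g s $ 2 $ 2 > 0" by (rule order_tendstoD) simp
  hence ev: "\<forall>\<^sub>F s in nhds 0. g s $ 2 $ 2 > 0"
    by (simp add: eventually_nhds_conv_at g0 mat2_entries)
  have eq: "\<forall>\<^sub>F s in nhds 0. \<pi> (g s) v = \<pi> (nilm (n s)) (\<pi> (diagm (a s)) (\<pi> (rotm (th s)) v))"
    using ev
  proof eventually_elim
    case (elim s)
    have "g s = nilm (n s) ** diagm (a s) ** rotm (th s)"
      unfolding n_def a_def th_def by (rule iwasawa_decomposition[OF gSL elim])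
    thus ?case by (metis \<pi>_mult basis_SL2 SL2_mult)
  qed
  have "((\<lambda>s. \<pi> (g s) v) has_vector_derivative (- z *\<^sub>R DR v + x *\<^sub>R DA v) + (y + z) *\<^sub>R DN v) (at 0)"
    by (rule has_vector_derivative_cong_ev[THEN iffD2, OF _ _ 2])
      (use eq in \<open>auto elim: eventually_mono dest: eventually_nhds_x_imp_x\<close>)
  thus ?thesis by (simp add: Dlin_def algebra_simps)
qed

end

section \<open>Translates of smooth vectors and commutators of derivations\<close>

context unitary_representation
begin

lemma \<pi>_conjugate:
  assumes h: "h \<in> SL2" and g: "g \<in> SL2"
  shows "\<pi> h (\<pi> g v) = \<pi> (h ** g ** adj2 h) (\<pi> h v)"
proof -
  have "h ** g ** adj2 h ** h = h ** g"
    by (simp add: matrix_mul_assoc[symmetric] adj2_mult[OF h])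
  thus ?thesis by (metis \<pi>_mult h g SL2_mult SL2_adj2)
qed

lemma \<pi>_conjugate':
  assumes h: "h \<in> SL2" and g: "g \<in> SL2"
  shows "\<pi> g (\<pi> h v) = \<pi> h (\<pi> (adj2 h ** g ** h) v)"
proof -
  have "h ** (adj2 h ** g ** h) = g ** h"
    by (simp add: matrix_mul_assoc adj2_mult[OF h])
  thus ?thesis by (metis \<pi>_mult h g SL2_mult SL2_adj2)
qed

lemma smooth_Dlin: "v \<in> smooth \<Longrightarrow> Dlin x y z v \<in> smooth"
  unfolding Dlin_def by (intro smooth_intros)

text \<open>Rewriting \<open>\<gamma> s ** h\<close> as \<open>h\<close> times a conjugate of
  \<open>\<gamma> s\<close> moves the differentiation inside \<open>\<pi> h\<close>, where it acts
  on \<open>v\<close> along a curve through the identity.\<close>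

lemma translate_derivative:
  assumes c: "tangent_curve \<gamma> x y z" and h: "h \<in> SL2" and v: "v \<in> smooth"
  shows "((\<lambda>s. \<pi> (\<gamma> s) (\<pi> h v)) has_vector_derivative
    \<pi> h (Dlin (Ad1 (adj2 h) x y z) (Ad2 (adj2 h) x y z) (Ad3 (adj2 h) x y z) v)) (at 0)"
proof -
  have g: "\<gamma> s \<in> SL2" for s using c by (simp add: tangent_curve_def)
  from bounded_linear.has_vector_derivative[OF \<pi>_bounded_linear[OF h]
      curve_derivative[OF tangent_curve_Ad[OF c SL2_adj2[OF h]] v]]
  show ?thesis by (simp add: \<pi>_conjugate'[OF h g])
qed

lemma smooth_\<pi>:
  assumes "h \<in> SL2" "v \<in> smooth"
  shows "\<pi> h v \<in> smooth"
proof (rule smooth_vecs_coinduct[of _ "\<pi> h ` smooth"])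
  fix w \<gamma> assume "w \<in> \<pi> h ` smooth" and \<gamma>: "\<gamma> \<in> {rotm, diagm, nilm}"
  then obtain v where w: "w = \<pi> h v" "v \<in> smooth" by blast
  obtain x y z where c: "tangent_curve \<gamma> x y z" using basis_tangent_curve[OF \<gamma>] .
  note D = translate_derivative[OF c assms(1) w(2), folded w(1)]
  show "(\<lambda>t. \<pi> (\<gamma> t) w) differentiable at 0 \<and> Dgen \<pi> \<gamma> w \<in> \<pi> h ` smooth"
    using differentiableI_vector[OF D] Dgen_eqI[OF D] smooth_Dlin[OF w(2)] by auto
qed (use assms in blast)

text \<open>Equivariance of the derived action under the adjoint representation: the same curve is
  differentiated before and after conjugating by \<open>h\<close>.\<close>

lemma \<pi>_Dgen:
  assumes \<gamma>: "\<gamma> \<in> {rotm, diagm, nilm}" and c: "tangent_curve \<gamma> x y z"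
    and h: "h \<in> SL2" and v: "v \<in> smooth"
  shows "\<pi> h (Dgen \<pi> \<gamma> v) = Dlin (Ad1 h x y z) (Ad2 h x y z) (Ad3 h x y z) (\<pi> h v)"
proof -
  have g: "\<gamma> s \<in> SL2" for s using c by (simp add: tangent_curve_def)
  have "((\<lambda>s. \<pi> h (\<pi> (\<gamma> s) v)) has_vector_derivative \<pi> h (Dgen \<pi> \<gamma> v)) (at 0)"
    by (rule bounded_linear.has_vector_derivative[OF \<pi>_bounded_linear[OF h] smooth_has_derivative[OF v \<gamma>]])
  moreover have "((\<lambda>s. \<pi> h (\<pi> (\<gamma> s) v)) has_vector_derivative
      Dlin (Ad1 h x y z) (Ad2 h x y z) (Ad3 h x y z) (\<pi> h v)) (at 0)"
    using curve_derivative[OF tangent_curve_Ad[OF c h] smooth_\<pi>[OF h v]]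
    by (simp add: \<pi>_conjugate[OF h g])
  ultimately show ?thesis by (rule vector_derivative_unique_at)
qed

text \<open>A smooth vector is only known to be differentiable along one-parameter subgroups at the
  identity, so the commutator is computed weakly, tested against the smooth vector that is to
  be shown to vanish.\<close>
lemma Dgen_commutator:
  assumes \<gamma>: "\<gamma> \<in> {rotm, diagm, nilm}" and c: "tangent_curve \<gamma> x y z"
    and \<gamma>': "\<gamma>' \<in> {rotm, diagm, nilm}" and c': "tangent_curve \<gamma>' x' y' z'"
    and v: "v \<in> smooth"
  shows "Dgen \<pi> \<gamma> (Dgen \<pi> \<gamma>' v) - Dgen \<pi> \<gamma>' (Dgen \<pi> \<gamma> v)
    = Dlin (y * z' - y' * z) (2 * (x * y' - x' * y)) (2 * (z * x' - z' * x)) v"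
    (is "?L = ?R")
proof -
  define w where "w = ?L - ?R"
  have w: "w \<in> smooth"
    unfolding w_def by (intro smooth_intros smooth_Dlin Dgen_smooth \<gamma> \<gamma>' v)
  have g: "\<gamma>' s \<in> SL2" for s using c' by (simp add: tangent_curve_def)
  have g0: "\<gamma>' 0 = mat 1" using c' by (simp add: tangent_curve_def)
  have D: "((\<lambda>s. \<gamma>' s $ 1 $ 1) has_real_derivative x') (at 0)"
    "((\<lambda>s. \<gamma>' s $ 1 $ 2) has_real_derivative y') (at 0)"
    "((\<lambda>s. \<gamma>' s $ 2 $ 1) has_real_derivative z') (at 0)"
    "((\<lambda>s. \<gamma>' s $ 2 $ 2) has_real_derivative - x') (at 0)"
    using c' unfolding tangent_curve_def by auto
  \<comment> \<open>Coordinates of the Lie algebra element of \<open>\<gamma>\<close> conjugated by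
    the inverse of \<open>\<gamma>' t\<close>; their derivatives at 0 are the coordinates of the
    matrix bracket.\<close>
  define c1 where "c1 t = Ad1 (adj2 (\<gamma>' t)) x y z" for t
  define c2 where "c2 t = Ad2 (adj2 (\<gamma>' t)) x y z" for t
  define c3 where "c3 t = Ad3 (adj2 (\<gamma>' t)) x y z" for t
  note Adefs = Ad1_def Ad2_def Ad3_def adj2_def mat2_entries
  have c0: "c1 0 = x" "c2 0 = y" "c3 0 = z"
    by (simp_all add: c1_def c2_def c3_def g0 Adefs)
  have c1': "(c1 has_real_derivative y * z' - y' * z) (at 0)"
    unfolding c1_def Adefs by (rule derivative_eq_intros D refl | simp add: g0 mat2_entries)+
  have c2': "(c2 has_real_derivative 2 * (x * y' - x' * y)) (at 0)"
    unfolding c2_def Adefs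
    by (rule derivative_eq_intros D refl | simp add: g0 mat2_entries algebra_simps)+
  have c3': "(c3 has_real_derivative 2 * (z * x' - z' * x)) (at 0)"
    unfolding c3_def Adefs
    by (rule derivative_eq_intros D refl | simp add: g0 mat2_entries algebra_simps)+
  define u where "u t = Dlin (c1 t) (c2 t) (c3 t) v" for t
  have u': "(u has_vector_derivative ?R) (at 0)"
    unfolding u_def Dlin_def
    by (rule derivative_eq_intros c1' c2' c3' refl)+ (simp add: algebra_simps)
  have u0: "u 0 = Dgen \<pi> \<gamma> v"
    unfolding u_def c0 using curve_derivative[OF c v] Dgen_eqI by metis
  have "((\<lambda>t. \<pi> (\<gamma>' t) (u t)) has_vector_derivative ?R + Dgen \<pi> \<gamma>' (Dgen \<pi> \<gamma> v)) (at 0)"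
    by (rule product_derivative[OF g g0 \<pi>_tendsto_along_curve[OF c'] u'])
      (unfold u0, rule smooth_has_derivative[OF Dgen_smooth[OF v \<gamma>] \<gamma>'])
  moreover have "Dgen \<pi> \<gamma> (\<pi> (\<gamma>' t) v) = \<pi> (\<gamma>' t) (u t)" for t
    unfolding u_def c1_def c2_def c3_def
    by (rule Dgen_eqI[OF translate_derivative[OF c g v]])
  ultimately have "((\<lambda>t. ip (Dgen \<pi> \<gamma> (\<pi> (\<gamma>' t) v)) w) has_vector_derivative
      ip (?R + Dgen \<pi> \<gamma>' (Dgen \<pi> \<gamma> v)) w) (at 0)"
    using bounded_linear.has_vector_derivative[OF bounded_bilinear.bounded_linear_left[OF bounded_bilinear_ip]]
    by simp
  \<comment> \<open>Skew-symmetry moves the derivation along \<open>\<gamma>\<close> onto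
    \<open>w\<close>, so that \<open>t\<close> enters only through the orbit of \<open>v\<close>,
    whose derivative is known. Comparing the two derivatives gives the weak identity.\<close>
  hence "((\<lambda>t. - ip (\<pi> (\<gamma>' t) v) (Dgen \<pi> \<gamma> w)) has_vector_derivative
      ip (?R + Dgen \<pi> \<gamma>' (Dgen \<pi> \<gamma> v)) w) (at 0)"
    by (simp add: Dgen_skew[OF \<gamma> smooth_\<pi>[OF g v] w])
  moreover have "((\<lambda>t. - ip (\<pi> (\<gamma>' t) v) (Dgen \<pi> \<gamma> w)) has_vector_derivative
      - ip (Dgen \<pi> \<gamma>' v) (Dgen \<pi> \<gamma> w)) (at 0)"
    by (intro has_vector_derivative_minus
        bounded_linear.has_vector_derivative[OF bounded_bilinear.bounded_linear_left[OF bounded_bilinear_ip]]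
        smooth_has_derivative v \<gamma>')
  ultimately have "ip (?R + Dgen \<pi> \<gamma>' (Dgen \<pi> \<gamma> v)) w = - ip (Dgen \<pi> \<gamma>' v) (Dgen \<pi> \<gamma> w)"
    by (rule vector_derivative_unique_at)
  also have "\<dots> = ip (Dgen \<pi> \<gamma> (Dgen \<pi> \<gamma>' v)) w"
    using Dgen_skew[OF \<gamma> Dgen_smooth[OF v \<gamma>'] w] by simp
  finally have "ip (?L - ?R) w = 0"
    by (simp add: ip_diff_left ip_add_left) (simp add: algebra_simps)
  hence "ip w w = 0" by (simp only: w_def[symmetric])
  hence "w = 0" by (simp add: ip_self)
  thus ?thesis by (simp add: w_def)
qed

lemma DR_DA: "v \<in> smooth \<Longrightarrow> DR (DA v) = DA (DR v) + 2 *\<^sub>R DR v - 4 *\<^sub>R DN v"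
  and DR_DN: "v \<in> smooth \<Longrightarrow> DR (DN v) = DN (DR v) + DA v"
  and DA_DN: "v \<in> smooth \<Longrightarrow> DA (DN v) = DN (DA v) + 2 *\<^sub>R DN v"
  using Dgen_commutator[OF _ tangent_curve_basis(1) _ tangent_curve_basis(2), of v]
    Dgen_commutator[OF _ tangent_curve_basis(1) _ tangent_curve_basis(3), of v]
    Dgen_commutator[OF _ tangent_curve_basis(2) _ tangent_curve_basis(3), of v]
  by (simp_all add: Dlin_def algebra_simps)

section \<open>Weight, raising and lowering operators and their relations\<close>

abbreviation "H \<equiv> opH J \<pi>"
abbreviation "E \<equiv> opE J \<pi>"
abbreviation "F \<equiv> opEb J \<pi>"

lemma smooth_op: "v \<in> smooth \<Longrightarrow> H v \<in> smooth" "v \<in> smooth \<Longrightarrow> E v \<in> smooth"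
  "v \<in> smooth \<Longrightarrow> F v \<in> smooth"
  unfolding opH_def opE_def opEb_def by (intro smooth_intros; assumption)+

lemma op_add:
  assumes "u \<in> smooth" "v \<in> smooth"
  shows "H (u + v) = H u + H v" "E (u + v) = E u + E v" "F (u + v) = F u + F v"
  unfolding opH_def opE_def opEb_def
  by (simp_all add: Dgen_add assms cscale_add_right)

lemma op_cscale:
  assumes "v \<in> smooth"
  shows "H (cscale J z v) = cscale J z (H v)" "E (cscale J z v) = cscale J z (E v)"
    "F (cscale J z v) = cscale J z (F v)"
  unfolding opH_def opE_def opEb_def
  by (simp_all add: Dgen_cscale assms cscale_add_right cscale_cscale mult.commute)

lemma op_scaleR:
  assumes "v \<in> smooth"
  shows "H (r *\<^sub>R v) = r *\<^sub>R H v" "E (r *\<^sub>R v) = r *\<^sub>R E v" "F (r *\<^sub>R v) = r *\<^sub>R F v"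
  using op_cscale[OF assms, of "of_real r"] by (simp_all add: cscale_of_real)

lemma op_diff:
  assumes "u \<in> smooth" "v \<in> smooth"
  shows "H (u - v) = H u - H v" "E (u - v) = E u - E v" "F (u - v) = F u - F v"
  using op_add[OF assms(1) smooth_uminus[OF assms(2)]] op_scaleR[OF assms(2), of "-1"] by simp_all

lemma H_symmetric: "u \<in> smooth \<Longrightarrow> v \<in> smooth \<Longrightarrow> ip (H u) v = ip u (H v)"
  unfolding opH_def by (simp add: ip_simps Dgen_skew)

text \<open>The real generators are skew, and \<open>opE\<close> and \<open>opEb\<close> have
  complex conjugate coefficients, so the adjoint of one is minus the other.\<close>

lemma E_adjoint: "u \<in> smooth \<Longrightarrow> v \<in> smooth \<Longrightarrow> ip (E u) v = - ip u (F v)"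
  unfolding opE_def opEb_def by (simp add: ip_simps Dgen_skew algebra_simps)

lemma F_adjoint: "u \<in> smooth \<Longrightarrow> v \<in> smooth \<Longrightarrow> ip (F u) v = - ip u (E v)"
  unfolding opE_def opEb_def by (simp add: ip_simps Dgen_skew algebra_simps)

lemma Dgen_J:
  assumes "v \<in> smooth" "\<gamma> \<in> {rotm, diagm, nilm}"
  shows "Dgen \<pi> \<gamma> (J v) = J (Dgen \<pi> \<gamma> v)" "J v \<in> smooth"
  using Dgen_cscale[OF assms(2,1), of \<i>] smooth_cscale[OF assms(1), of \<i>] by (simp_all add: cscale_def)

text \<open>Writing the complex coefficients through \<open>J\<close> reduces the commutator
  relations to real-linear algebra in \<open>DA\<close>, \<open>DN\<close> and
  \<open>DR\<close>.\<close>

lemma op_real_form: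
  "H v = - (1/2) *\<^sub>R J (DR v)"
  "E v = (1/2) *\<^sub>R DA v + J (DN v) - (1/2) *\<^sub>R J (DR v)"
  "F v = (1/2) *\<^sub>R DA v - J (DN v) + (1/2) *\<^sub>R J (DR v)"
  by (simp_all add: opH_def opE_def opEb_def cscale_def Re_divide Im_divide)

lemma Dgen_E_terms:
  assumes "v \<in> smooth" "\<gamma> \<in> {rotm, diagm, nilm}"
  shows "Dgen \<pi> \<gamma> (a *\<^sub>R DA v + b *\<^sub>R J (DN v) + c *\<^sub>R J (DR v))
    = a *\<^sub>R Dgen \<pi> \<gamma> (DA v) + b *\<^sub>R J (Dgen \<pi> \<gamma> (DN v)) + c *\<^sub>R J (Dgen \<pi> \<gamma> (DR v))"
  using assms by (simp add: Dgen_add Dgen_scaleR Dgen_J smooth_intros)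

lemma D_E: "v \<in> smooth \<Longrightarrow> \<gamma> \<in> {rotm, diagm, nilm} \<Longrightarrow> Dgen \<pi> \<gamma> (E v) =
    (1/2) *\<^sub>R Dgen \<pi> \<gamma> (DA v) + J (Dgen \<pi> \<gamma> (DN v)) - (1/2) *\<^sub>R J (Dgen \<pi> \<gamma> (DR v))"
  using Dgen_E_terms[of v \<gamma> "1/2" 1 "-1/2"] by (simp add: op_real_form)

lemma D_F: "v \<in> smooth \<Longrightarrow> \<gamma> \<in> {rotm, diagm, nilm} \<Longrightarrow> Dgen \<pi> \<gamma> (F v) =
    (1/2) *\<^sub>R Dgen \<pi> \<gamma> (DA v) - J (Dgen \<pi> \<gamma> (DN v)) + (1/2) *\<^sub>R J (Dgen \<pi> \<gamma> (DR v))"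
  using Dgen_E_terms[of v \<gamma> "1/2" "-1" "1/2"] by (simp add: op_real_form)

lemma D_H: "v \<in> smooth \<Longrightarrow> \<gamma> \<in> {rotm, diagm, nilm} \<Longrightarrow> Dgen \<pi> \<gamma> (H v) =
    - (1/2) *\<^sub>R J (Dgen \<pi> \<gamma> (DR v))"
  using Dgen_E_terms[of v \<gamma> 0 0 "-1/2"] by (simp add: op_real_form)

lemma commutator_E_F: "v \<in> smooth \<Longrightarrow> E (F v) = F (E v) + 2 *\<^sub>R H v"
  unfolding op_real_form(2)[of "F v"] op_real_form(3)[of "E v"] op_real_form(1)[of v]
  by (simp add: D_E D_F DR_DA DR_DN DA_DN J_simps algebra_simps)
    (simp add: scaleR_left_distrib[symmetric])

lemma commutator_H_E: "v \<in> smooth \<Longrightarrow> H (E v) = E (H v) + E v"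
  by (simp add: op_real_form(1)[of "E v"] op_real_form(2)[of "H v"] D_E D_H DR_DA DR_DN DA_DN
      J_simps algebra_simps)
    (simp add: op_real_form(2)[of v] algebra_simps scaleR_left_distrib[symmetric])

end

section \<open>K-finite vectors and closed invariant subspaces under differentiation\<close>

context unitary_representation
begin

lemma irreducible_subD:
  assumes "irreducible_sub J \<pi> M"
  shows "closed M" "csubspace J M" "invariant_sub \<pi> M"
  using assms[unfolded irreducible_sub_def, THEN conjunct1]
    assms[unfolded irreducible_sub_def, THEN conjunct2, THEN conjunct1]
    assms[unfolded irreducible_sub_def, THEN conjunct2, THEN conjunct2, THEN conjunct1] .

lemma Kfinite_J:
  assumes "Kfinite \<pi> v" shows "Kfinite \<pi> (J v)"
proof -
  obtain B where B: "finite B" "range (\<lambda>t. \<pi> (rotm t) v) \<subseteq> span B"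
    using assms unfolding Kfinite_def by blast
  have "\<pi> (rotm t) (J v) = J (\<pi> (rotm t) v)" for t
    using \<pi>_cscale[OF basis_SL2(1), of t \<i>] by (simp add: cscale_def)
  hence "range (\<lambda>t. \<pi> (rotm t) (J v)) \<subseteq> span (J ` B)"
    using B(2) linear_span_image[OF linear_J] by auto
  thus ?thesis unfolding Kfinite_def using B(1) by blast
qed

lemma Dgen_in_closed_invariant:
  assumes V: "closed V" "csubspace J V" "invariant_sub \<pi> V"
    and v: "v \<in> V" "v \<in> smooth" and \<gamma>: "\<gamma> \<in> {rotm, diagm, nilm}"
  shows "Dgen \<pi> \<gamma> v \<in> V"
proof (rule Lim_in_closed_set[OF V(1)])
  obtain x y z where "tangent_curve \<gamma> x y z" using basis_tangent_curve[OF \<gamma>] .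
  hence "\<gamma> 0 = mat 1" by (simp add: tangent_curve_def)
  thus "((\<lambda>s. (\<pi> (\<gamma> s) v - v) /\<^sub>R s) \<longlongrightarrow> Dgen \<pi> \<gamma> v) (at 0)"
    using smooth_has_derivative[OF v(2) \<gamma>] unfolding has_vector_derivative_at_0_iff by simp
  have "\<pi> (\<gamma> s) v \<in> V" for s
    using V(3) v(1) basis_in_SL2[OF \<gamma>] unfolding invariant_sub_def by blast
  thus "\<forall>\<^sub>F s in at 0. (\<pi> (\<gamma> s) v - v) /\<^sub>R s \<in> V"
    by (intro always_eventually allI csubspace_scaleR[OF V(2)] csubspace_diff[OF V(2)] v(1))
qed simp

text \<open>Rotating a derivative of \<open>v\<close> gives a derivative, in a conjugated direction,
  of a rotated \<open>v\<close>. All of these lie in the span of the derivatives of finitely many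
  vectors spanning the K-orbit.\<close>

lemma Kfinite_Dgen:
  assumes v: "v \<in> smooth" "Kfinite \<pi> v" and \<gamma>: "\<gamma> \<in> {rotm, diagm, nilm}"
  shows "Kfinite \<pi> (Dgen \<pi> \<gamma> v)"
proof -
  let ?O = "range (\<lambda>t. \<pi> (rotm t) v)"
  obtain B where B: "finite B" "?O \<subseteq> span B" using v(2) unfolding Kfinite_def by blast
  \<comment> \<open>The basis is taken inside the orbit, so that its members are smooth; the vectors
    of \<open>B\<close> may fail to be.\<close>
  obtain B' where B': "B' \<subseteq> ?O" "independent B'" "?O \<subseteq> span B'"
    using maximal_independent_subset by blast
  have fin: "finite B'"
    using independent_span_bound[OF B(1) B'(2)] B'(1) B(2) by blast
  have B's: "B' \<subseteq> smooth" using B'(1) smooth_\<pi>[OF basis_SL2(1) v(1)] by blast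
  define C where "C = DA ` B' \<union> DN ` B' \<union> DR ` B'"
  have C: "Dgen \<pi> \<delta> b \<in> C" if "\<delta> \<in> {rotm, diagm, nilm}" "b \<in> B'" for \<delta> b
    using that unfolding C_def by auto
  have "u \<in> smooth \<and> (\<forall>\<delta>\<in>{rotm, diagm, nilm}. Dgen \<pi> \<delta> u \<in> span C)" if "u \<in> span B'" for u
    using that
  proof (induction rule: span_induct_alt)
    case base
    have "Dgen \<pi> \<delta> 0 = 0" if "\<delta> \<in> {rotm, diagm, nilm}" for \<delta>
      using Dgen_scaleR[OF that smooth_0, of 0] by simp
    thus ?case using smooth_0 span_zero by metis
  next
    case (step c x y)
    have x: "x \<in> smooth" using step B's by blast
    have "Dgen \<pi> \<delta> (c *\<^sub>R x + y) \<in> span C" if \<delta>: "\<delta> \<in> {rotm, diagm, nilm}" for \<delta>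
    proof -
      have y: "y \<in> smooth" "Dgen \<pi> \<delta> y \<in> span C" using step \<delta> by blast+
      have "Dgen \<pi> \<delta> x \<in> span C" using C[OF \<delta>] step by (blast intro: span_base)
      thus ?thesis
        unfolding Dgen_add[OF \<delta> smooth_scaleR[OF x] y(1)] Dgen_scaleR[OF \<delta> x]
        by (intro span_add span_scale y)
    qed
    thus ?case using step x by (simp add: smooth_add smooth_scaleR)
  qed
  hence D: "Dgen \<pi> \<delta> u \<in> span C" if "u \<in> span B'" "\<delta> \<in> {rotm, diagm, nilm}" for u \<delta>
    using that by blast
  have "\<pi> (rotm t) (Dgen \<pi> \<gamma> v) \<in> span C" for t
  proof -
    obtain x y z where c: "tangent_curve \<gamma> x y z" using basis_tangent_curve[OF \<gamma>] .
    have "\<pi> (rotm t) v \<in> span B'" using B'(3) by blast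
    hence "Dlin x y z (\<pi> (rotm t) v) \<in> span C" for x y z
      unfolding Dlin_def using D by (intro span_add span_diff span_scale) auto
    thus ?thesis unfolding \<pi>_Dgen[OF \<gamma> c basis_SL2(1) v(1)] .
  qed
  moreover have "finite C" unfolding C_def using fin by simp
  ultimately show ?thesis unfolding Kfinite_def by blast
qed

end

section \<open>Multiplicative representations\<close>

locale multiplicative_representation =
  fixes J :: "'h::{real_normed_vector,banach} \<Rightarrow> 'h"
    and ip :: "'h \<Rightarrow> 'h \<Rightarrow> complex"
    and \<pi> :: "real^2^2 \<Rightarrow> 'h \<Rightarrow> 'h"
    and Hfin :: "'h set"
    and mul :: "'h \<Rightarrow> 'h \<Rightarrow> 'h"
    and one :: 'h
  assumes multiplicative: "multiplicative_rep J ip \<pi> Hfin mul one"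
begin

sublocale unitary_representation J ip \<pi>
  by unfold_locales (rule multiplicative[unfolded multiplicative_rep_def, THEN conjunct1])

abbreviation "cj \<equiv> conjv ip Hfin mul"

lemma mul_smooth: "a \<in> Hfin \<Longrightarrow> b \<in> Hfin \<Longrightarrow> mul a b \<in> smooth"
  and mul_add_left: "a \<in> Hfin \<Longrightarrow> b \<in> Hfin \<Longrightarrow> c \<in> Hfin \<Longrightarrow> mul (a + b) c = mul a c + mul b c"
  and mul_add_right: "a \<in> Hfin \<Longrightarrow> b \<in> Hfin \<Longrightarrow> c \<in> Hfin \<Longrightarrow> mul a (b + c) = mul a b + mul a c"
  and mul_cscale_left: "a \<in> Hfin \<Longrightarrow> b \<in> Hfin \<Longrightarrow> mul (cscale J z a) b = cscale J z (mul a b)"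
  and mul_cscale_right: "a \<in> Hfin \<Longrightarrow> b \<in> Hfin \<Longrightarrow> mul a (cscale J z b) = cscale J z (mul a b)"
  and mul_commute: "a \<in> Hfin \<Longrightarrow> b \<in> Hfin \<Longrightarrow> mul a b = mul b a"
  and one_Hfin: "one \<in> Hfin"
  and mul_one: "a \<in> Hfin \<Longrightarrow> mul one a = a"
  and invariants: "{v. \<forall>g\<in>SL2. \<pi> g v = v} = range (\<lambda>z. cscale J z one)"
  and Dgen_mul: "\<gamma> \<in> {rotm, diagm, nilm} \<Longrightarrow> a \<in> Hfin \<Longrightarrow> b \<in> Hfin \<Longrightarrow>
    Dgen \<pi> \<gamma> (mul a b) = mul (Dgen \<pi> \<gamma> a) b + mul a (Dgen \<pi> \<gamma> b)"
  and conjugate_exists: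
    "a \<in> Hfin \<Longrightarrow> \<exists>x\<in>Hfin. \<forall>b\<in>Hfin. \<forall>c\<in>Hfin. ip (mul a b) c = ip b (mul x c)"
  and crossing_symmetry: "(\<forall>i<4. \<alpha> i \<in> Hfin) \<Longrightarrow> \<sigma> permutes {..<4::nat} \<Longrightarrow>
        ip (mul (\<alpha> 0) (\<alpha> 1)) (mul (cj (\<alpha> 2)) (cj (\<alpha> 3))) =
        ip (mul (\<alpha> (\<sigma> 0)) (\<alpha> (\<sigma> 1))) (mul (cj (\<alpha> (\<sigma> 2))) (cj (\<alpha> (\<sigma> 3))))"
proof -
  note m = multiplicative[unfolded multiplicative_rep_def, THEN conjunct2, THEN conjunct2]
  show "a \<in> Hfin \<Longrightarrow> b \<in> Hfin \<Longrightarrow> mul a b \<in> smooth"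
    using m[THEN conjunct1] by blast
  note m = m[THEN conjunct2]
  show "a \<in> Hfin \<Longrightarrow> b \<in> Hfin \<Longrightarrow> c \<in> Hfin \<Longrightarrow> mul (a + b) c = mul a c + mul b c"
    using m[THEN conjunct1] by blast
  note m = m[THEN conjunct2]
  show "a \<in> Hfin \<Longrightarrow> b \<in> Hfin \<Longrightarrow> c \<in> Hfin \<Longrightarrow> mul a (b + c) = mul a b + mul a c"
    using m[THEN conjunct1] by blast
  note m = m[THEN conjunct2]
  show "a \<in> Hfin \<Longrightarrow> b \<in> Hfin \<Longrightarrow> mul (cscale J z a) b = cscale J z (mul a b)"
    using m[THEN conjunct1] by blast
  note m = m[THEN conjunct2]
  show "a \<in> Hfin \<Longrightarrow> b \<in> Hfin \<Longrightarrow> mul a (cscale J z b) = cscale J z (mul a b)"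
    using m[THEN conjunct1] by blast
  note m = m[THEN conjunct2]
  show "a \<in> Hfin \<Longrightarrow> b \<in> Hfin \<Longrightarrow> mul a b = mul b a"
    using m[THEN conjunct1] by blast
  note m = m[THEN conjunct2]
  show "one \<in> Hfin"
    by (rule m[THEN conjunct1])
  note m = m[THEN conjunct2, THEN conjunct2]
  show "a \<in> Hfin \<Longrightarrow> mul one a = a"
    using m[THEN conjunct1] by blast
  note m = m[THEN conjunct2]
  show "{v. \<forall>g\<in>SL2. \<pi> g v = v} = range (\<lambda>z. cscale J z one)"
    by (rule m[THEN conjunct1])
  note m = m[THEN conjunct2]
  show "\<gamma> \<in> {rotm, diagm, nilm} \<Longrightarrow> a \<in> Hfin \<Longrightarrow> b \<in> Hfin \<Longrightarrow>
    Dgen \<pi> \<gamma> (mul a b) = mul (Dgen \<pi> \<gamma> a) b + mul a (Dgen \<pi> \<gamma> b)"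
    using m[THEN conjunct1] by blast
  note m = m[THEN conjunct2]
  show "a \<in> Hfin \<Longrightarrow> \<exists>x\<in>Hfin. \<forall>b\<in>Hfin. \<forall>c\<in>Hfin. ip (mul a b) c = ip b (mul x c)"
    using m[THEN conjunct1] by blast
  show "(\<forall>i<4. \<alpha> i \<in> Hfin) \<Longrightarrow> \<sigma> permutes {..<4::nat} \<Longrightarrow>
        ip (mul (\<alpha> 0) (\<alpha> 1)) (mul (cj (\<alpha> 2)) (cj (\<alpha> 3))) =
        ip (mul (\<alpha> (\<sigma> 0)) (\<alpha> (\<sigma> 1))) (mul (cj (\<alpha> (\<sigma> 2))) (cj (\<alpha> (\<sigma> 3))))"
    using m[THEN conjunct2] by blast
qed

text \<open>Products are smooth, and \<open>a\<close> is its own product with the unit.\<close>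

lemma Hfin_smooth: "a \<in> Hfin \<Longrightarrow> a \<in> smooth"
  using mul_smooth[OF one_Hfin, of a] by (simp add: mul_one)

lemma Hfin_span:
  obtains I :: "nat set" and V where "\<forall>i\<in>I. irreducible_sub J \<pi> (V i)"
    "Hfin = span (\<Union>i\<in>I. {v\<in>V i. Kfinite \<pi> v})"
  using multiplicative[unfolded multiplicative_rep_def, THEN conjunct2, THEN conjunct1]
  unfolding discrete_spectrum_def by (elim exE conjE) (rule that)

lemma Hfin_subspace: "subspace Hfin"
  by (rule Hfin_span) (simp add: subspace_span)

lemma Hfin_scaleR: "a \<in> Hfin \<Longrightarrow> r *\<^sub>R a \<in> Hfin"
  and Hfin_add: "a \<in> Hfin \<Longrightarrow> b \<in> Hfin \<Longrightarrow> a + b \<in> Hfin"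
  and Hfin_diff: "a \<in> Hfin \<Longrightarrow> b \<in> Hfin \<Longrightarrow> a - b \<in> Hfin"
  and Hfin_0: "0 \<in> Hfin"
  using Hfin_subspace
  by (auto simp: subspace_scale subspace_add subspace_diff subspace_0)

text \<open>\<open>Hfin\<close> is given as a real span, so stability under \<open>J\<close> is
  checked on the generators, each of which lies in a complex summand.\<close>

lemma Hfin_J:
  assumes "a \<in> Hfin" shows "J a \<in> Hfin"
proof -
  obtain I :: "nat set" and V where IV: "\<forall>i\<in>I. irreducible_sub J \<pi> (V i)"
    "Hfin = span (\<Union>i\<in>I. {v\<in>V i. Kfinite \<pi> v})" by (rule Hfin_span)
  let ?S = "\<Union>i\<in>I. {v\<in>V i. Kfinite \<pi> v}"
  have "J ` ?S \<subseteq> ?S"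
  proof safe
    fix i v assume *: "i \<in> I" "v \<in> V i" "Kfinite \<pi> v"
    have "cscale J \<i> v \<in> V i"
      using irreducible_subD(2)[OF bspec[OF IV(1) *(1)]] *(2) unfolding csubspace_def by blast
    thus "J v \<in> ?S" using * Kfinite_J by (auto simp: cscale_def)
  qed
  hence "J ` span ?S \<subseteq> span ?S"
    unfolding linear_span_image[OF linear_J, symmetric] by (rule span_mono)
  thus ?thesis using assms IV(2) by blast
qed

lemma Hfin_cscale: "a \<in> Hfin \<Longrightarrow> cscale J z a \<in> Hfin"
  unfolding cscale_def by (intro Hfin_add Hfin_scaleR Hfin_J)

text \<open>On a generator, the derivative stays in its summand because that is closed and
  invariant, and it stays K-finite; linearity does the rest.\<close>

lemma Hfin_Dgen:
  assumes a: "a \<in> Hfin" and \<gamma>: "\<gamma> \<in> {rotm, diagm, nilm}"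
  shows "Dgen \<pi> \<gamma> a \<in> Hfin"
proof -
  obtain I :: "nat set" and V where IV: "\<forall>i\<in>I. irreducible_sub J \<pi> (V i)"
    "Hfin = span (\<Union>i\<in>I. {v\<in>V i. Kfinite \<pi> v})" by (rule Hfin_span)
  let ?S = "\<Union>i\<in>I. {v\<in>V i. Kfinite \<pi> v}"
  have S: "Dgen \<pi> \<gamma> v \<in> Hfin" "v \<in> Hfin" if v: "v \<in> ?S" for v
  proof -
    show vf: "v \<in> Hfin" unfolding IV(2) using v by (rule span_base)
    obtain i where i: "i \<in> I" "v \<in> V i" "Kfinite \<pi> v" using v by blast
    have "Dgen \<pi> \<gamma> v \<in> V i"
      by (rule Dgen_in_closed_invariant[OF irreducible_subD[OF bspec[OF IV(1) i(1)]] i(2)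
            Hfin_smooth[OF vf] \<gamma>])
    hence "Dgen \<pi> \<gamma> v \<in> ?S" using i Kfinite_Dgen[OF Hfin_smooth[OF vf] i(3) \<gamma>] by blast
    thus "Dgen \<pi> \<gamma> v \<in> Hfin" unfolding IV(2) by (rule span_base)
  qed
  have "a \<in> span ?S" using a IV(2) by simp
  hence "a \<in> Hfin \<and> Dgen \<pi> \<gamma> a \<in> Hfin"
  proof (induction rule: span_induct_alt)
    case base
    show ?case using Dgen_scaleR[OF \<gamma> smooth_0, of 0] Hfin_0 by simp
  next
    case (step c x y)
    thus ?case using S[of x]
      by (simp add: Dgen_add[OF \<gamma>] Dgen_scaleR[OF \<gamma>] smooth_scaleR Hfin_smooth Hfin_add Hfin_scaleR)
  qed
  thus ?thesis ..
qed

lemma Hfin_op: "a \<in> Hfin \<Longrightarrow> H a \<in> Hfin" "a \<in> Hfin \<Longrightarrow> E a \<in> Hfin" "a \<in> Hfin \<Longrightarrow> F a \<in> Hfin"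
  unfolding opH_def opE_def opEb_def by (auto intro!: Hfin_add Hfin_cscale Hfin_Dgen)

lemma mul_scaleR_left: "a \<in> Hfin \<Longrightarrow> b \<in> Hfin \<Longrightarrow> mul (r *\<^sub>R a) b = r *\<^sub>R mul a b"
  and mul_scaleR_right: "a \<in> Hfin \<Longrightarrow> b \<in> Hfin \<Longrightarrow> mul a (r *\<^sub>R b) = r *\<^sub>R mul a b"
  using mul_cscale_left[of a b "of_real r"] mul_cscale_right[of a b "of_real r"]
  by (simp_all add: cscale_of_real)

lemma op_mul:
  assumes "a \<in> Hfin" "b \<in> Hfin"
  shows "H (mul a b) = mul (H a) b + mul a (H b)"
    "E (mul a b) = mul (E a) b + mul a (E b)" "F (mul a b) = mul (F a) b + mul a (F b)"
  unfolding opH_def opE_def opEb_def using assms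
  by (simp_all add: Dgen_mul mul_add_left mul_add_right mul_cscale_left mul_cscale_right
      cscale_add_right Hfin_Dgen Hfin_cscale Hfin_add)

section \<open>Conjugation on the finite part\<close>

lemma cj_unique:
  assumes "x \<in> Hfin" "x' \<in> Hfin" "\<And>b. b \<in> Hfin \<Longrightarrow> ip b x = ip b x'"
  shows "x = x'"
proof -
  have "ip (x - x') (x - x') = 0" using assms(3)[OF Hfin_diff[OF assms(1,2)]] by (simp add: ip_diff_right)
  thus ?thesis by (simp add: ip_self)
qed

text \<open>Putting \<open>c = one\<close> in the defining identity determines \<open>ip b x\<close>
  for all \<open>b\<close> in \<open>Hfin\<close>. This gives the uniqueness that
  \<open>conjv\<close>, a definite description, relies on.\<close>

lemma cj:
  assumes "a \<in> Hfin"
  shows cj_Hfin: "cj a \<in> Hfin"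
    and ip_mul_cj: "b \<in> Hfin \<Longrightarrow> c \<in> Hfin \<Longrightarrow> ip (mul a b) c = ip b (mul (cj a) c)"
proof -
  have "\<exists>!x. x \<in> Hfin \<and> (\<forall>b\<in>Hfin. \<forall>c\<in>Hfin. ip (mul a b) c = ip b (mul x c))"
  proof (rule ex_ex1I)
    show "\<exists>x. x \<in> Hfin \<and> (\<forall>b\<in>Hfin. \<forall>c\<in>Hfin. ip (mul a b) c = ip b (mul x c))"
      using conjugate_exists[OF assms] by blast
    fix x x'
    assume x: "x \<in> Hfin \<and> (\<forall>b\<in>Hfin. \<forall>c\<in>Hfin. ip (mul a b) c = ip b (mul x c))"
      and x': "x' \<in> Hfin \<and> (\<forall>b\<in>Hfin. \<forall>c\<in>Hfin. ip (mul a b) c = ip b (mul x' c))"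
    show "x = x'"
    proof (rule cj_unique)
      fix b assume "b \<in> Hfin"
      hence "ip b (mul x one) = ip b (mul x' one)" using x x' one_Hfin by metis
      thus "ip b x = ip b x'" using x x' one_Hfin mul_one mul_commute by metis
    qed (use x x' in auto)
  qed
  from theI'[OF this, folded conjv_def]
  show "cj a \<in> Hfin" and "b \<in> Hfin \<Longrightarrow> c \<in> Hfin \<Longrightarrow> ip (mul a b) c = ip b (mul (cj a) c)" by auto
qed

text \<open>Characterises the conjugate by a single linear functional of \<open>b\<close>; together
  with \<open>cj_eqI\<close> it reduces later identities about \<open>cj\<close> to pairings with
  the unit.\<close>

lemma ip_cj: "a \<in> Hfin \<Longrightarrow> b \<in> Hfin \<Longrightarrow> ip b (cj a) = ip (mul a b) one"
  using ip_mul_cj[OF _ _ one_Hfin] mul_one mul_commute cj_Hfin one_Hfin by metis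

lemma cj_eqI:
  assumes "a \<in> Hfin" "x \<in> Hfin" "\<And>b. b \<in> Hfin \<Longrightarrow> ip b x = ip (mul a b) one"
  shows "cj a = x"
  by (rule cj_unique) (use assms cj_Hfin ip_cj in auto)

lemma cj_cj: "a \<in> Hfin \<Longrightarrow> cj (cj a) = a"
proof (rule cj_eqI)
  fix b assume "a \<in> Hfin" "b \<in> Hfin"
  have "ip (mul (cj a) b) one = cnj (ip one (mul (cj a) b))" by (rule ip_commute)
  also have "\<dots> = cnj (ip (mul a one) b)"
    using ip_mul_cj \<open>a \<in> Hfin\<close> \<open>b \<in> Hfin\<close> one_Hfin by metis
  also have "\<dots> = ip b a"
    using mul_one mul_commute one_Hfin \<open>a \<in> Hfin\<close> ip_commute by metis
  finally show "ip b a = ip (mul (cj a) b) one" ..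
qed (auto intro: cj_Hfin)

lemma cj_add: "a \<in> Hfin \<Longrightarrow> b \<in> Hfin \<Longrightarrow> cj (a + b) = cj a + cj b"
  by (rule cj_eqI) (auto simp: Hfin_add cj_Hfin ip_add_right ip_cj mul_add_left ip_add_left)

lemma cj_cscale: "a \<in> Hfin \<Longrightarrow> cj (cscale J z a) = cscale J (cnj z) (cj a)"
  by (rule cj_eqI) (auto simp: Hfin_cscale cj_Hfin ip_cscale_right ip_cj mul_cscale_left ip_cscale_left)

lemma cj_scaleR: "a \<in> Hfin \<Longrightarrow> cj (r *\<^sub>R a) = r *\<^sub>R cj a"
  using cj_cscale[of a "of_real r"] by (simp add: cscale_of_real)

lemma Dgen_one:
  assumes \<gamma>: "\<gamma> \<in> {rotm, diagm, nilm}" shows "Dgen \<pi> \<gamma> one = 0"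
proof (rule Dgen_eqI)
  have "one = cscale J 1 one" by (simp add: cscale_def)
  hence "one \<in> range (\<lambda>z. cscale J z one)" by (rule range_eqI)
  hence "\<pi> g one = one" if "g \<in> SL2" for g using invariants that by blast
  thus "((\<lambda>t. \<pi> (\<gamma> t) one) has_vector_derivative 0) (at 0)" using basis_in_SL2[OF \<gamma>] by simp
qed

text \<open>Integration by parts: a derivative of \<open>mul a b\<close> is orthogonal to the
  invariant vector \<open>one\<close>, and the product rule splits it into the two pairings to be
  compared.\<close>

lemma cj_Dgen:
  assumes a: "a \<in> Hfin" and \<gamma>: "\<gamma> \<in> {rotm, diagm, nilm}"
  shows "cj (Dgen \<pi> \<gamma> a) = Dgen \<pi> \<gamma> (cj a)"
proof (rule cj_eqI)
  fix b assume b: "b \<in> Hfin"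
  have "0 = ip (Dgen \<pi> \<gamma> (mul a b)) one"
    using Dgen_skew[OF \<gamma> mul_smooth[OF a b] Hfin_smooth[OF one_Hfin]] by (simp add: Dgen_one[OF \<gamma>])
  also have "\<dots> = ip (mul (Dgen \<pi> \<gamma> a) b) one + ip (Dgen \<pi> \<gamma> b) (cj a)"
    using a b \<gamma> by (simp add: Dgen_mul ip_add_left ip_cj Hfin_Dgen)
  also have "ip (Dgen \<pi> \<gamma> b) (cj a) = - ip b (Dgen \<pi> \<gamma> (cj a))"
    by (intro Dgen_skew \<gamma> Hfin_smooth a b cj_Hfin)
  finally show "ip b (Dgen \<pi> \<gamma> (cj a)) = ip (mul (Dgen \<pi> \<gamma> a) b) one" by simp
qed (intro Hfin_Dgen cj_Hfin a \<gamma>)+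

text \<open>Conjugation commutes with the real generators and conjugates scalars, so it exchanges
  \<open>E\<close> and \<open>F\<close> and reverses the sign of weights.\<close>

lemma cj_op:
  assumes "a \<in> Hfin"
  shows "cj (H a) = - H (cj a)" "cj (E a) = F (cj a)" "cj (F a) = E (cj a)"
  using assms unfolding opH_def opE_def opEb_def
  by (simp_all add: cj_add cj_cscale cj_Dgen Hfin_Dgen Hfin_cscale Hfin_add)
    (simp add: cscale_def)

lemma crossing:
  assumes "a \<in> Hfin" "b \<in> Hfin" "c \<in> Hfin" "d \<in> Hfin"
  shows "ip (mul a (cj b)) (mul c (cj d)) = ip (mul a d) (mul c b)"
proof -
  \<comment> \<open>Slots 1 and 3 are to be exchanged. Slots 1 and 2 carry conjugates so that, by
    \<open>cj_cj\<close>, the conjugations in the crossing identity land as required.\<close>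
  define \<alpha> :: "nat \<Rightarrow> 'h" where
    "\<alpha> i = (if i = 0 then a else if i = 1 then cj b else if i = 2 then cj c else d)" for i
  define \<sigma> :: "nat \<Rightarrow> nat" where "\<sigma> = Transposition.transpose 1 3"
  have "\<forall>i<4. \<alpha> i \<in> Hfin" unfolding \<alpha>_def using assms by (auto intro: cj_Hfin)
  moreover have "\<sigma> permutes {..<4}" unfolding \<sigma>_def by (rule permutes_swap_id) auto
  ultimately have "ip (mul (\<alpha> 0) (\<alpha> 1)) (mul (cj (\<alpha> 2)) (cj (\<alpha> 3))) =
        ip (mul (\<alpha> (\<sigma> 0)) (\<alpha> (\<sigma> 1))) (mul (cj (\<alpha> (\<sigma> 2))) (cj (\<alpha> (\<sigma> 3))))"
    by (rule crossing_symmetry)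
  thus ?thesis using assms by (simp add: \<alpha>_def \<sigma>_def Transposition.transpose_def cj_cj)
qed

end

section \<open>Spectral decomposition of the Casimir operator\<close>

text \<open>Only even powers occur, so an argument proportional to \<open>sqrt l\<close> produces
  integral powers of \<open>l\<close>, that is, moments of the Casimir operator.\<close>

lemma cosh_sums_even: "(\<lambda>n. t ^ (2 * n) / fact (2 * n)) sums cosh (t::real)"
proof -
  have "(\<lambda>n. (if even (2 * n) then t ^ (2 * n) /\<^sub>R fact (2 * n) else 0)) sums cosh t"
    using cosh_converges[of t]
    by (subst sums_mono_reindex[of "\<lambda>n. 2 * n" "\<lambda>n. if even n then t ^ n /\<^sub>R fact n else 0"])
      (auto simp: strict_mono_def elim!: evenE)
  thus ?thesis by (simp add: divide_inverse mult.commute)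
qed

context complex_hilbert_space
begin

lemma oproj_eqI:
  assumes M: "closed M" "csubspace J M" and "m \<in> M" "\<And>u. u \<in> M \<Longrightarrow> ip (v - m) u = 0"
  shows "oproj ip M v = m"
proof -
  let ?p = "oproj ip M v"
  have "m - ?p \<in> M" by (intro csubspace_diff M oproj_in assms(3))
  hence "ip (v - ?p) (m - ?p) - ip (v - m) (m - ?p) = 0"
    using oproj_orth[OF M] assms(4) by simp
  hence "ip (m - ?p) (m - ?p) = 0" unfolding ip_diff_left[symmetric] by simp
  thus ?thesis by (simp add: ip_self)
qed

lemma csubspace_closure:
  assumes "csubspace J S" shows "csubspace J (closure S)"
  unfolding csubspace_def
proof (intro conjI ballI allI)
  have S: "0 \<in> S" "\<And>u v. u \<in> S \<Longrightarrow> v \<in> S \<Longrightarrow> u + v \<in> S" "\<And>z v. v \<in> S \<Longrightarrow> cscale J z v \<in> S"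
    using assms unfolding csubspace_def by auto
  show "0 \<in> closure S" using S(1) closure_subset by blast
  fix u assume "u \<in> closure S"
  then obtain p where p: "\<And>n. p n \<in> S" "p \<longlonglongrightarrow> u" unfolding closure_sequential by blast
  show "cscale J z u \<in> closure S" for z
    unfolding closure_sequential using p S(3) bounded_linear.tendsto[OF bounded_linear_cscale p(2)]
    by (intro exI[of _ "\<lambda>n. cscale J z (p n)"]) auto
  fix v assume "v \<in> closure S"
  then obtain q where q: "\<And>n. q n \<in> S" "q \<longlonglongrightarrow> v" unfolding closure_sequential by blast
  show "u + v \<in> closure S"
    unfolding closure_sequential using p q S(2) tendsto_add[OF p(2) q(2)]
    by (intro exI[of _ "\<lambda>n. p n + q n"]) auto
qed

lemma ip_eq_0_closure:
  assumes "\<And>w. w \<in> S \<Longrightarrow> ip v w = 0" "w \<in> closure S"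
  shows "ip v w = 0"
proof -
  have "closed ((\<lambda>w. ip v w) -` {0})"
    by (intro closed_vimage closed_singleton linear_continuous_on
        bounded_bilinear.bounded_linear_right[OF bounded_bilinear_ip])
  moreover have "S \<subseteq> (\<lambda>w. ip v w) -` {0}" using assms(1) by auto
  ultimately have "closure S \<subseteq> (\<lambda>w. ip v w) -` {0}" by (rule closure_minimal[rotated])
  thus ?thesis using assms(2) by auto
qed

end

section \<open>Casimir eigenspaces, moments and exponential weights\<close>

context unitary_representation
begin

abbreviation "\<Delta> \<equiv> casimir J \<pi>"

lemma casimir_smooth: "v \<in> smooth \<Longrightarrow> \<Delta> v \<in> smooth"
  unfolding casimir_def by (intro smooth_intros smooth_op)

lemma casimir_add: "u \<in> smooth \<Longrightarrow> v \<in> smooth \<Longrightarrow> \<Delta> (u + v) = \<Delta> u + \<Delta> v"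
  unfolding casimir_def by (simp add: op_add smooth_op cscale_add_right algebra_simps)

lemma casimir_cscale: "v \<in> smooth \<Longrightarrow> \<Delta> (cscale J z v) = cscale J z (\<Delta> v)"
  unfolding casimir_def
  by (simp add: op_cscale smooth_op cscale_add_right cscale_cscale mult.commute)
    (simp add: cscale_def J_simps algebra_simps)

lemma casimir_scaleR: "v \<in> smooth \<Longrightarrow> \<Delta> (r *\<^sub>R v) = r *\<^sub>R \<Delta> v"
  using casimir_cscale[of v "of_real r"] by (simp add: cscale_of_real)

lemma casimir_pow:
  assumes "v \<in> smooth"
  shows casimir_pow_smooth: "(\<Delta> ^^ n) v \<in> smooth"
    and casimir_pow_scaleR: "(\<Delta> ^^ n) (r *\<^sub>R v) = r *\<^sub>R (\<Delta> ^^ n) v"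
proof -
  have *: "(\<Delta> ^^ n) v \<in> smooth \<and> (\<Delta> ^^ n) (r *\<^sub>R v) = r *\<^sub>R (\<Delta> ^^ n) v" for r
    by (induction n) (auto simp: assms casimir_smooth casimir_scaleR)
  show "(\<Delta> ^^ n) v \<in> smooth" "(\<Delta> ^^ n) (r *\<^sub>R v) = r *\<^sub>R (\<Delta> ^^ n) v" using *[of r] by auto
qed

lemma casimir_pow_add:
  assumes "u \<in> smooth" "v \<in> smooth"
  shows "(\<Delta> ^^ n) (u + v) = (\<Delta> ^^ n) u + (\<Delta> ^^ n) v"
  by (induction n) (auto simp: assms casimir_pow_smooth casimir_add)

lemma casimir_pow_diff:
  assumes "u \<in> smooth" "v \<in> smooth"
  shows "(\<Delta> ^^ n) (u - v) = (\<Delta> ^^ n) u - (\<Delta> ^^ n) v"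
  using casimir_pow_add[OF assms(1) smooth_uminus[OF assms(2)], of n]
    casimir_pow_scaleR[OF assms(2), of n "-1"] by simp

lemma casimir_symmetric:
  assumes "u \<in> smooth" "v \<in> smooth" shows "ip (\<Delta> u) v = ip u (\<Delta> v)"
  unfolding casimir_def using assms
  by (simp add: ip_simps H_symmetric E_adjoint F_adjoint smooth_op algebra_simps)

definition eigenspace :: "real \<Rightarrow> 'h set" where
  "eigenspace l = {w \<in> smooth. \<Delta> w = cscale J (of_real l) w}"

lemma eigenspace_csubspace: "csubspace J (eigenspace l)"
proof -
  have "\<Delta> 0 = 0" using casimir_scaleR[OF smooth_0, of 0] by simp
  thus ?thesis unfolding csubspace_def eigenspace_def
    by (auto simp: smooth_intros casimir_add casimir_cscale cscale_add_right cscale_cscale mult.commute)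
qed

text \<open>On eigenvectors this is symmetry of the Casimir operator. Vectors in the closures need
  not be smooth, so the statement is extended by continuity in one argument at a time.\<close>

lemma eigenspace_orthogonal:
  assumes "l \<noteq> l'" "u \<in> closure (eigenspace l)" "w \<in> closure (eigenspace l')"
  shows "ip u w = 0"
proof (rule ip_eq_0_closure[OF _ assms(3)])
  fix w assume w: "w \<in> eigenspace l'"
  have "ip w u = 0"
  proof (rule ip_eq_0_closure[OF _ assms(2)])
    fix u assume u: "u \<in> eigenspace l"
    have "of_real l' * ip w u = ip (\<Delta> w) u" using w by (simp add: eigenspace_def cscale_of_real ip_simps)
    also have "\<dots> = ip w (\<Delta> u)" by (rule casimir_symmetric) (use u w in \<open>auto simp: eigenspace_def\<close>)
    also have "\<dots> = of_real l * ip w u" using u by (simp add: eigenspace_def cscale_of_real ip_simps)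
    finally show "ip w u = 0" using assms(1) by simp
  qed
  thus "ip u w = 0" using ip_commute[of u w] by simp
qed

lemma casimir_proj_eq: "casimir_proj J ip \<pi> l v = oproj ip (closure (eigenspace l)) v"
  unfolding casimir_proj_def eigenspace_def ..

lemmas eigenspace_closure = closed_closure csubspace_closure[OF eigenspace_csubspace]

text \<open>The projection of \<open>v\<close> lies only in a closure and might not be smooth, so
  the Casimir operator is moved onto eigenvectors in the inner product, and the identity is extended
  by continuity.\<close>

lemma casimir_proj_pow:
  assumes v: "v \<in> smooth"
  shows "casimir_proj J ip \<pi> l ((\<Delta> ^^ n) v) = (l ^ n) *\<^sub>R casimir_proj J ip \<pi> l v"
  unfolding casimir_proj_eq
proof (rule oproj_eqI[OF eigenspace_closure])
  let ?P = "oproj ip (closure (eigenspace l)) v"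
  have P: "?P \<in> closure (eigenspace l)" by (rule oproj_in[OF eigenspace_closure])
  show "(l ^ n) *\<^sub>R ?P \<in> closure (eigenspace l)" by (rule csubspace_scaleR[OF eigenspace_closure(2) P])
  have pow: "ip ((\<Delta> ^^ n) v) w = of_real (l ^ n) * ip v w" if w: "w \<in> eigenspace l" for w
  proof (induction n)
    case (Suc n)
    have ws: "w \<in> smooth" and we: "\<Delta> w = l *\<^sub>R w" using w by (auto simp: eigenspace_def cscale_of_real)
    have "ip ((\<Delta> ^^ Suc n) v) w = ip ((\<Delta> ^^ n) v) (\<Delta> w)"
      using casimir_symmetric[OF casimir_pow_smooth[OF v] ws] by simp
    also have "\<dots> = of_real (l ^ Suc n) * ip v w" by (simp add: we ip_simps Suc)
    finally show ?case .
  qed simp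
  fix u assume u: "u \<in> closure (eigenspace l)"
  have "ip ((\<Delta> ^^ n) v - (l ^ n) *\<^sub>R v) u = 0"
    by (rule ip_eq_0_closure[OF _ u]) (simp add: ip_diff_left ip_scaleR_left pow)
  moreover have "ip (v - ?P) u = 0" by (rule oproj_orth[OF eigenspace_closure u])
  ultimately show "ip ((\<Delta> ^^ n) v - (l ^ n) *\<^sub>R ?P) u = 0"
    by (simp add: ip_diff_left ip_scaleR_left)
qed

lemma casimir_bessel:
  assumes "finite L" shows "(\<Sum>l\<in>L. (norm (casimir_proj J ip \<pi> l v))\<^sup>2) \<le> (norm v)\<^sup>2"
  unfolding casimir_proj_eq
  by (rule bessel_projections[OF assms eigenspace_closure]) (rule eigenspace_orthogonal)

text \<open>One factor takes all powers of \<open>l\<close> through \<open>casimir_proj_pow\<close>;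
  Cauchy-Schwarz for the finite sum and Bessel's inequality for each factor finish.\<close>

lemma casimir_moment_le:
  assumes v: "v \<in> smooth" and L: "finite L"
  shows "(\<Sum>l\<in>L. l ^ n * (norm (casimir_proj J ip \<pi> l v))\<^sup>2) \<le> norm ((\<Delta> ^^ n) v) * norm v"
proof -
  let ?P = "casimir_proj J ip \<pi>"
  have L2: "L2_set (\<lambda>l. norm (?P l u)) L \<le> norm u" for u
    unfolding L2_set_def using casimir_bessel[OF L, of u] by (simp add: real_le_lsqrt)
  have "(\<Sum>l\<in>L. l ^ n * (norm (?P l v))\<^sup>2) \<le> (\<Sum>l\<in>L. \<bar>norm (?P l ((\<Delta> ^^ n) v))\<bar> * \<bar>norm (?P l v)\<bar>)"
    unfolding casimir_proj_pow[OF v]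
    by (intro sum_mono) (auto simp: power2_eq_square mult.assoc[symmetric] intro!: mult_right_mono)
  also have "\<dots> \<le> L2_set (\<lambda>l. norm (?P l ((\<Delta> ^^ n) v))) L * L2_set (\<lambda>l. norm (?P l v)) L"
    by (rule L2_set_mult_ineq)
  also have "\<dots> \<le> norm ((\<Delta> ^^ n) v) * norm v"
    by (intro mult_mono L2 L2_set_nonneg norm_ge_zero)
  finally show ?thesis .
qed

text \<open>Squaring the weight doubles \<open>c\<close>. For \<open>l\<close> at least 0 the
  squared weight is at most twice a hyperbolic cosine, whose series is integrated term by term
  against the moments; finite partial sums are bounded uniformly.\<close>

lemma exp_casimir_finite:
  assumes v: "v \<in> smooth"
    and S: "summable (\<lambda>n. (2 * c) ^ (2 * n) / fact (2 * n) * norm ((\<Delta> ^^ n) v))" and c: "c > 0"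
  shows "fun_casimir_finite J ip \<pi> (\<lambda>l. complex_of_real (exp (c * sqrt l))) v"
  unfolding fun_casimir_finite_def
proof (rule nonneg_bdd_above_summable_on)
  let ?P = "\<lambda>l. (norm (casimir_proj J ip \<pi> l v))\<^sup>2"
  let ?b = "\<lambda>n. (2 * c) ^ (2 * n) / fact (2 * n) * (norm ((\<Delta> ^^ n) v) * norm v)"
  have b: "summable ?b" using summable_mult2[OF S, of "norm v"] by (simp add: mult.assoc)
  have pos: "(\<Sum>l\<in>L. exp (2 * c * sqrt l) * ?P l) \<le> 2 * suminf ?b"
    if L: "finite L" "\<And>l. l \<in> L \<Longrightarrow> l \<ge> 0" for L
  proof -
    have "(\<Sum>l\<in>L. exp (2 * c * sqrt l) * ?P l) \<le> (\<Sum>l\<in>L. 2 * cosh (2 * c * sqrt l) * ?P l)"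
      by (intro sum_mono mult_right_mono) (auto simp: cosh_def)
    also have "\<dots> = 2 * (\<Sum>l\<in>L. cosh (2 * c * sqrt l) * ?P l)"
      by (simp add: sum_distrib_left mult.assoc)
    also have "(\<Sum>l\<in>L. cosh (2 * c * sqrt l) * ?P l) \<le> suminf ?b"
    proof -
      have sums: "(\<lambda>n. \<Sum>l\<in>L. (2 * c * sqrt l) ^ (2 * n) / fact (2 * n) * ?P l) sums
          (\<Sum>l\<in>L. cosh (2 * c * sqrt l) * ?P l)"
        by (intro sums_sum sums_mult2 cosh_sums_even)
      have "(\<Sum>l\<in>L. (2 * c * sqrt l) ^ (2 * n) / fact (2 * n) * ?P l) \<le> ?b n" for n
      proof -
        have "(\<Sum>l\<in>L. (2 * c * sqrt l) ^ (2 * n) / fact (2 * n) * ?P l)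
            = (2 * c) ^ (2 * n) / fact (2 * n) * (\<Sum>l\<in>L. l ^ n * ?P l)"
          unfolding sum_distrib_left
        proof (intro sum.cong refl)
          fix l assume "l \<in> L"
          hence "sqrt l ^ (2 * n) = l ^ n" using L(2) by (simp add: power_mult)
          thus "(2 * c * sqrt l) ^ (2 * n) / fact (2 * n) * ?P l
              = (2 * c) ^ (2 * n) / fact (2 * n) * (l ^ n * ?P l)"
            by (simp add: power_mult_distrib)
        qed
        also have "\<dots> \<le> ?b n"
          by (intro mult_left_mono casimir_moment_le v L(1)) (simp add: power_mult)
        finally show ?thesis .
      qed
      thus ?thesis using sums_le[OF _ sums summable_sums[OF b]] by blast
    qed
    finally show ?thesis by simp
  qed
  have sq: "(cmod (complex_of_real (exp (c * sqrt l))))\<^sup>2 = exp (2 * c * sqrt l)" for l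
    by (simp add: power2_eq_square exp_add[symmetric])
  show "bdd_above (sum (\<lambda>l. (cmod (complex_of_real (exp (c * sqrt l))))\<^sup>2 * ?P l) ` {L. L \<subseteq> UNIV \<and> finite L})"
  proof (rule bdd_aboveI2)
    fix L :: "real set" assume "L \<in> {L. L \<subseteq> UNIV \<and> finite L}"
    hence L: "finite L" by simp
    let ?g = "\<lambda>l. exp (2 * c * sqrt l) * ?P l"
    have "sum ?g L = sum ?g (L \<inter> {0..}) + sum ?g (L - {0..})"
      by (rule sum.Int_Diff[OF L])
    also have "sum ?g (L \<inter> {0..}) \<le> 2 * suminf ?b" using L by (intro pos) auto
    also have "sum ?g (L - {0..}) \<le> sum ?P (L - {0..})"
    proof (intro sum_mono)
      fix l assume "l \<in> L - {0..}"
      \<comment> \<open>For negative \<open>l\<close> the value \<open>sqrt l\<close> is negative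
        (odd extension), so the weight is at most 1 and Bessel's inequality bounds these
        terms.\<close>
      hence "2 * c * sqrt l \<le> 0" using c by (auto intro: mult_nonneg_nonpos)
      hence "exp (2 * c * sqrt l) \<le> 1" by simp
      thus "?g l \<le> ?P l" by (intro mult_left_le_one_le) auto
    qed
    also have "\<dots> \<le> (norm v)\<^sup>2" using L by (intro casimir_bessel) auto
    finally show "sum (\<lambda>l. (cmod (complex_of_real (exp (c * sqrt l))))\<^sup>2 * ?P l) L
        \<le> 2 * suminf ?b + (norm v)\<^sup>2" unfolding sq by simp
  qed
qed auto

end

section \<open>Lowest weight vectors\<close>

text \<open>The real-variable core. It will be applied with \<open>x j\<close> the squared norms of
  the \<open>v j\<close>, \<open>y j\<close> the inner products of neighbours, and
  \<open>p j\<close> the norms of the lowered vectors.\<close>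

lemma geometric_growth:
  fixes k :: real and a x y p :: "nat \<Rightarrow> real"
  assumes k: "k > 0" and a: "\<And>j. a j = real j * (2 * k + real j - 1)"
    and x: "\<And>j. x j \<ge> 0" and p: "\<And>j. p j \<ge> 0"
    and y: "\<And>j. a (Suc j) * y j = a j * y (j - 1) + (k + real j) * x j"
    and p_le: "\<And>j. (p j)\<^sup>2 \<le> (a j + a (Suc j)) * x j"
    and x_le: "\<And>j. a (Suc j) * x (Suc j) \<le> p j * p (Suc j) + (a j + a (Suc j)) * y j"
  shows "x j \<le> max (x 0) (x 1) * 16 ^ j"
proof -
  have apos: "a (Suc j) > 0" for j unfolding a using k by (intro mult_pos_pos) auto
  have a0: "a j \<ge> 0" for j by (cases j) (use apos less_imp_le a in auto)
  have amono: "a j \<le> a (Suc j)" for j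
  proof -
    have "a (Suc j) - a j = 2 * (k + real j)" unfolding a by (simp add: algebra_simps)
    thus ?thesis using k by simp
  qed
  \<comment> \<open>The increment \<open>a (Suc i) - a i = 2 * (k + real i)\<close> is twice the
    weight of \<open>x i\<close> in the recursion, so the bound \<open>B / 2\<close> reproduces
    itself.\<close>
  have y_le: "y j \<le> B / 2" if B: "\<And>i. i \<le> j \<Longrightarrow> x i \<le> B" for j B
  proof -
    have "i \<le> j \<Longrightarrow> a (Suc i) * y i \<le> a (Suc i) * (B / 2)" for i
    proof (induction i)
      case 0
      have "k * x 0 \<le> k * B" using B[of 0] k by (intro mult_left_mono) auto
      moreover have "a (Suc 0) * y 0 = k * x 0" using y[of 0] by (simp add: a[of 0])
      moreover have "a (Suc 0) * (B / 2) = k * B" by (simp add: a)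
      ultimately show ?case by linarith
    next
      case (Suc i)
      have "(k + real (Suc i)) * x (Suc i) \<le> (k + real (Suc i)) * B"
        using B[of "Suc i"] Suc.prems k by (intro mult_left_mono) auto
      hence "a (Suc (Suc i)) * y (Suc i) \<le> a (Suc i) * (B / 2) + (k + real (Suc i)) * B"
        using y[of "Suc i"] Suc by simp
      also have "\<dots> = a (Suc (Suc i)) * (B / 2)" unfolding a by (simp add: field_simps)
      finally show ?case .
    qed
    thus ?thesis using apos[of j] by (metis mult_le_cancel_left_pos order_refl)
  qed
  \<comment> \<open>If \<open>x (Suc j)\<close> exceeded 16 times all earlier values, both terms on
    the right of \<open>x_le\<close> would be small fractions of its left side
    \<open>b\<close>.\<close>
  have step: "x (Suc j) \<le> 16 * B" if B: "\<And>i. i \<le> j \<Longrightarrow> x i \<le> B" and j: "j \<ge> 1" for j B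
  proof (rule ccontr)
    assume "\<not> x (Suc j) \<le> 16 * B"
    hence big: "B < x (Suc j) / 16" by simp
    let ?a = "a (Suc j)" and ?x = "x (Suc j)"
    have B0: "B \<ge> 0" using B[of j] x[of j] by simp
    have xp: "?x > 0" using big B0 by simp
    \<comment> \<open>The ratio is bounded uniformly in \<open>k\<close> only from
      \<open>j = 1\<close> on: at \<open>j = 0\<close> it is \<open>2 + 1 / k\<close>. This is why
      both \<open>x 0\<close> and \<open>x 1\<close> enter the final constant.\<close>
    have a2: "a (Suc (Suc j)) \<le> 4 * ?a"
    proof -
      have "a (Suc (Suc j)) = (real j + 2) * (2 * k + real j + 1)"
        unfolding a by (simp add: algebra_simps)
      also have "\<dots> \<le> (2 * (real j + 1)) * (2 * (2 * k + real j))"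
        using j k by (intro mult_mono) auto
      also have "\<dots> = 4 * ?a" unfolding a by (simp add: algebra_simps)
      finally show ?thesis .
    qed
    define b where "b = ?a * ?x"
    have b: "b > 0" unfolding b_def using apos[of j] xp by simp
    have "(p j)\<^sup>2 \<le> (a j + ?a) * x j" by (rule p_le)
    also have "\<dots> \<le> (2 * ?a) * (?x / 16)"
      using amono[of j] a0[of j] B[of j] x[of j] big apos[of j] by (intro mult_mono) auto
    finally have p1: "(p j)\<^sup>2 \<le> b / 8" by (simp add: b_def)
    have "(p (Suc j))\<^sup>2 \<le> (?a + a (Suc (Suc j))) * ?x" by (rule p_le)
    also have "\<dots> \<le> (5 * ?a) * ?x" using a2 xp by (intro mult_right_mono) auto
    finally have p2: "(p (Suc j))\<^sup>2 \<le> 5 * b" by (simp add: b_def)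
    have "(p j * p (Suc j))\<^sup>2 = (p j)\<^sup>2 * (p (Suc j))\<^sup>2" by (rule power_mult_distrib)
    also have "\<dots> \<le> b / 8 * (5 * b)" using p1 p2 b by (intro mult_mono) auto
    \<comment> \<open>Here 5/8 is at most 16/25. With the later term \<open>b / 16\<close>, the
      total is 69/80 of \<open>b\<close>, below \<open>b\<close>.\<close>
    also have "\<dots> \<le> (4 / 5 * b)\<^sup>2" by (simp add: power2_eq_square)
    finally have pp: "p j * p (Suc j) \<le> 4 / 5 * b"
      by (rule power2_le_imp_le) (use b in simp)
    have "(a j + ?a) * y j \<le> (a j + ?a) * (B / 2)"
      using y_le[OF B] a0 by (intro mult_left_mono) (auto intro: add_nonneg_nonneg)
    also have "\<dots> \<le> (2 * ?a) * (?x / 16 / 2)"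
      using amono[of j] a0 big B0 apos[of j] by (intro mult_mono) auto
    also have "\<dots> = b / 16" by (simp add: b_def)
    finally have "b \<le> 4 / 5 * b + b / 16" using x_le[of j] pp unfolding b_def by linarith
    thus False using b by simp
  qed
  define C where "C = max (x 0) (x 1)"
  have C0: "C \<ge> 0" unfolding C_def using x[of 0] by simp
  have "x j \<le> C * 16 ^ j"
  proof (induction j rule: less_induct)
    case (less j)
    consider "j = 0" | "j = 1" | i where "j = Suc i" "i \<ge> 1" by (cases j) force+
    thus ?case
    proof cases
      case 3
      have "x m \<le> C * 16 ^ i" if "m \<le> i" for m
      proof -
        have "x m \<le> C * 16 ^ m" using less[of m] that 3 by simp
        also have "\<dots> \<le> C * 16 ^ i" using that C0 by (intro mult_left_mono power_increasing) auto
        finally show ?thesis .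
      qed
      from step[OF this 3(2)] show ?thesis unfolding 3(1) by simp
    qed (use C0 in \<open>auto simp: C_def\<close>)
  qed
  thus ?thesis unfolding C_def .
qed

text \<open>Ratio test: the quotient of consecutive terms tends to 1/4, and it is at most 1/2 once
  \<open>n\<close> is at least \<open>2 * k\<close>.\<close>

lemma summable_rising_product:
  fixes k :: real assumes k: "k > 0"
  shows "summable (\<lambda>n. (\<Prod>i<n. real (Suc i) * (2 * k + real (Suc i) - 1)) / fact (2 * n))"
proof -
  define P where "P n = (\<Prod>i<n. real (Suc i) * (2 * k + real (Suc i) - 1))" for n
  have P0: "P n \<ge> 0" for n unfolding P_def using k by (intro prod_nonneg) auto
  have ratio: "norm (P (Suc n) / fact (2 * Suc n)) \<le> 1/2 * norm (P n / fact (2 * n))"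
    if "n \<ge> nat \<lceil>2 * k\<rceil>" for n
  proof -
    have n: "2 * k \<le> real n" using that by linarith
    have f: "(fact (2 * Suc n) :: real) = (2 * real n + 2) * (2 * real n + 1) * fact (2 * n)"
      by (simp add: algebra_simps)
    have "P (Suc n) / fact (2 * Suc n) = (real n + 1) * (2 * k + real n) / ((2 * real n + 2) * (2 * real n + 1))
        * (P n / fact (2 * n))"
      unfolding f by (simp add: P_def mult.commute)
    also have "\<dots> \<le> 1/2 * (P n / fact (2 * n))"
    proof (rule mult_right_mono)
      have "(real n + 1) * (2 * k + real n) \<le> (real n + 1) * (2 * real n + 1)"
        using n by (intro mult_left_mono) auto
      thus "(real n + 1) * (2 * k + real n) / ((2 * real n + 2) * (2 * real n + 1)) \<le> 1/2"
        by (subst pos_divide_le_eq) (intro mult_pos_pos, auto simp: algebra_simps)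
    qed (use P0 in auto)
    finally show ?thesis using P0[of n] P0[of "Suc n"] by simp
  qed
  show ?thesis unfolding P_def[symmetric]
  proof (rule summable_ratio_test)
    show "(1/2 :: real) < 1" by simp
    show "norm (P (Suc n) / fact (2 * Suc n)) \<le> 1/2 * norm (P n / fact (2 * n))"
      if "nat \<lceil>2 * k\<rceil> \<le> n" for n using that by (rule ratio)
  qed
qed

section \<open>The Casimir operator in weight zero, and norms of raised vectors\<close>

context unitary_representation
begin

text \<open>In weight zero the square of \<open>H\<close> contributes nothing and, since their
  commutator is \<open>2 H\<close>, \<open>E\<close> and \<open>F\<close> commute on
  \<open>w\<close>.\<close>

lemma casimir_weight_0:
  assumes "w \<in> smooth" "H w = 0" shows "\<Delta> w = - E (F w)"
proof -
  have "H 0 = 0" using op_scaleR(1)[OF smooth_0, of 0] by simp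
  moreover have "F (E w) = E (F w)" using commutator_E_F[OF assms(1)] assms(2) by simp
  ultimately show ?thesis
    unfolding casimir_def assms(2) by (simp add: cscale_def scaleR_2[symmetric])
qed

text \<open>The Casimir form becomes the Gram form of \<open>F\<close>, which makes Cauchy-Schwarz
  available for it.\<close>

lemma ip_casimir_weight_0:
  assumes "w \<in> smooth" "H w = 0" "u \<in> smooth" shows "ip (\<Delta> w) u = ip (F w) (F u)"
  unfolding casimir_weight_0[OF assms(1,2)]
  by (simp add: ip_minus_left E_adjoint smooth_op assms)

text \<open>The commutator of \<open>E\<close> and \<open>F\<close> in norm form. It serves for
  squares of ladder vectors and for the sign of a lowest weight.\<close>

lemma norm_E_sq:
  assumes "u \<in> smooth" "H u = r *\<^sub>R u"
  shows "(norm (E u))\<^sup>2 = (norm (F u))\<^sup>2 + 2 * r * (norm u)\<^sup>2"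
proof -
  have "ip (E u) (E u) = - ip u (E (F u) - 2 *\<^sub>R H u)"
    using commutator_E_F[OF assms(1)] E_adjoint[OF assms(1) smooth_op(2)[OF assms(1)]] by simp
  also have "\<dots> = ip (F u) (F u) + of_real (2 * r) * ip u u"
    using F_adjoint[OF assms(1) smooth_op(3)[OF assms(1)]] by (simp add: assms(2) ip_simps)
  also have "\<dots> = of_real ((norm (F u))\<^sup>2 + 2 * r * (norm u)\<^sup>2)"
    unfolding ip_self by simp
  finally show ?thesis unfolding ip_self of_real_eq_iff .
qed

end

section \<open>The ladder generated by a lowest weight vector\<close>

locale lowest_weight = multiplicative_representation +
  fixes f :: 'a and k :: real
  assumes f: "f \<in> Hfin" and Hf: "H f = k *\<^sub>R f" and Ff: "F f = 0" and k: "k > 0"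
begin

definition a :: "nat \<Rightarrow> real" where "a j = real j * (2 * k + real j - 1)"

definition G :: "nat \<Rightarrow> 'a" where "G j = (E ^^ j) f"

lemma a_0 [simp]: "a 0 = 0" by (simp add: a_def)

lemma a_Suc_pos: "a (Suc j) > 0" unfolding a_def using k by (intro mult_pos_pos) auto

lemma a_nonneg: "a j \<ge> 0" by (cases j) (use a_Suc_pos less_imp_le in auto)

lemma a_Suc: "a (Suc j) = a j + 2 * (k + real j)" by (simp add: a_def algebra_simps)

lemma a_mono: "i \<le> j \<Longrightarrow> a i \<le> a j"
  by (rule lift_Suc_mono_le) (use k a_Suc in auto)

lemma G_Hfin: "G j \<in> Hfin" unfolding G_def by (induction j) (auto simp: f Hfin_op)

lemma G_smooth: "G j \<in> smooth" by (rule Hfin_smooth[OF G_Hfin])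

lemma cj_G_Hfin: "cj (G j) \<in> Hfin" by (rule cj_Hfin[OF G_Hfin])

lemma E_G: "E (G j) = G (Suc j)" by (simp add: G_def)

lemma H_G: "H (G j) = (k + real j) *\<^sub>R G j"
proof (induction j)
  case 0 show ?case by (simp add: G_def Hf)
next
  case (Suc j)
  have "H (G (Suc j)) = E (H (G j)) + G (Suc j)"
    unfolding E_G[symmetric] by (rule commutator_H_E[OF G_smooth])
  also have "\<dots> = (k + real j) *\<^sub>R G (Suc j) + G (Suc j)"
    by (simp only: Suc op_scaleR(2)[OF G_smooth] E_G)
  finally show ?case by (simp add: algebra_simps)
qed

text \<open>Each step adds the commutator term \<open>2 * (k + real j)\<close>, which is the
  increment of \<open>a\<close>. At \<open>j = 0\<close> the truncated index \<open>j - 1\<close> is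
  harmless because \<open>a 0 = 0\<close>; the same convention is used below.\<close>

lemma F_G: "F (G j) = (- a j) *\<^sub>R G (j - 1)"
proof (induction j)
  case 0 show ?case by (simp add: G_def Ff)
next
  case (Suc j)
  have "E (F (G j)) = (- a j) *\<^sub>R G (Suc (j - 1))"
    by (simp only: Suc op_scaleR(2)[OF G_smooth] E_G)
  also have "\<dots> = (- a j) *\<^sub>R G j" by (cases j) auto
  finally have "F (G (Suc j)) + 2 *\<^sub>R H (G j) = (- a j) *\<^sub>R G j"
    using commutator_E_F[OF G_smooth[of j]] by (simp only: E_G)
  hence "F (G (Suc j)) = (- a j) *\<^sub>R G j - 2 *\<^sub>R ((k + real j) *\<^sub>R G j)"
    by (simp only: H_G eq_diff_eq)
  also have "\<dots> = (- a (Suc j)) *\<^sub>R G (Suc j - 1)"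
    by (simp add: a_Suc algebra_simps)
  finally show ?case .
qed

text \<open>Conjugation turns the lowest weight ladder into a highest weight ladder of negative
  weights, climbed in \<open>j\<close> by \<open>F\<close>.\<close>

lemma F_cj_G: "F (cj (G j)) = cj (G (Suc j))"
  by (simp only: cj_op(2)[OF G_Hfin, symmetric] E_G)

lemma E_cj_G: "E (cj (G j)) = (- a j) *\<^sub>R cj (G (j - 1))"
  by (simp only: cj_op(3)[OF G_Hfin, symmetric] F_G cj_scaleR[OF G_Hfin])

lemma H_cj_G: "H (cj (G j)) = (- (k + real j)) *\<^sub>R cj (G j)"
proof -
  have "H (cj (G j)) = - cj (H (G j))" by (simp only: cj_op(1)[OF G_Hfin] minus_minus)
  also have "\<dots> = - ((k + real j) *\<^sub>R cj (G j))" by (simp only: H_G cj_scaleR[OF G_Hfin])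
  finally show ?thesis by (simp only: scaleR_minus_left)
qed

section \<open>Products of ladder vectors with conjugate ladder vectors\<close>

definition U :: "nat \<Rightarrow> nat \<Rightarrow> 'a" where "U i j = mul (G i) (cj (G j))"

lemma U_smooth: "U i j \<in> smooth" unfolding U_def by (rule mul_smooth[OF G_Hfin cj_G_Hfin])

lemma H_U: "H (U j j) = 0"
proof -
  have "H (U j j) = (k + real j) *\<^sub>R U j j + (- (k + real j)) *\<^sub>R U j j"
    by (simp only: U_def op_mul(1) H_G H_cj_G mul_scaleR_left mul_scaleR_right G_Hfin cj_G_Hfin)
  thus ?thesis by (simp only: scaleR_minus_left add.right_inverse)
qed

lemma E_U: "E (U i j) = U (Suc i) j - a j *\<^sub>R U i (j - 1)"
proof -
  have "E (U i j) = U (Suc i) j + (- a j) *\<^sub>R U i (j - 1)"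
    by (simp only: U_def op_mul(2) E_G E_cj_G mul_scaleR_right G_Hfin cj_G_Hfin)
  thus ?thesis by simp
qed

lemma F_U: "F (U i j) = U i (Suc j) - a i *\<^sub>R U (i - 1) j"
proof -
  have "F (U i j) = (- a i) *\<^sub>R U (i - 1) j + U i (Suc j)"
    by (simp only: U_def op_mul(3) F_G F_cj_G mul_scaleR_left G_Hfin cj_G_Hfin)
  thus ?thesis by simp
qed

text \<open>The operator \<open>F\<close> leads from the diagonal to \<open>U j (Suc j)\<close> and
  \<open>U (j - 1) j\<close>, and \<open>E\<close> brings both back, so the Casimir operator is
  tridiagonal on the diagonal products.\<close>

lemma casimir_U: "\<Delta> (U j j) = (a j + a (Suc j)) *\<^sub>R U j j - U (Suc j) (Suc j)
    - (a j)\<^sup>2 *\<^sub>R U (j - 1) (j - 1)"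
proof -
  have "a j *\<^sub>R U (Suc (j - 1)) j = a j *\<^sub>R U j j" by (cases j) auto
  hence "E (F (U j j)) = U (Suc j) (Suc j) - a (Suc j) *\<^sub>R U j j - a j *\<^sub>R U j j
      + (a j)\<^sup>2 *\<^sub>R U (j - 1) (j - 1)"
    by (simp add: F_U op_diff op_scaleR U_smooth smooth_scaleR E_U power2_eq_square scaleR_diff_right)
  thus ?thesis unfolding casimir_weight_0[OF U_smooth H_U] by (simp add: algebra_simps)
qed

text \<open>Crossing exchanges one factor of each product and removes the conjugates; the real point
  is that all these inner products are nonnegative.\<close>

lemma ip_U: "ip (U i i) (U j j) = of_real ((norm (mul (G i) (G j)))\<^sup>2)"
  unfolding U_def crossing[OF G_Hfin G_Hfin G_Hfin G_Hfin] mul_commute[OF G_Hfin[of j] G_Hfin[of i]]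
  by (rule ip_self)

text \<open>Apply \<open>norm_E_sq\<close> to the square of \<open>G j\<close>, of weight
  \<open>2 * (k + real j)\<close>: raising gives twice \<open>G j\<close> times
  \<open>G (Suc j)\<close>, lowering gives \<open>- 2 * a j\<close> times \<open>G (j - 1)\<close>
  times \<open>G j\<close>, and the common factor 4 cancels.\<close>

lemma norm_mul_G_Suc:
  "(norm (mul (G j) (G (Suc j))))\<^sup>2
    = (a j)\<^sup>2 * (norm (mul (G (j - 1)) (G j)))\<^sup>2 + (k + real j) * (norm (mul (G j) (G j)))\<^sup>2"
proof -
  let ?u = "mul (G j) (G j)"
  have Eu: "E ?u = 2 *\<^sub>R mul (G j) (G (Suc j))"
    using mul_commute[OF G_Hfin[of "Suc j"] G_Hfin[of j]]
    by (simp add: op_mul[OF G_Hfin G_Hfin] E_G scaleR_2)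
  have Fu: "F ?u = (- 2 * a j) *\<^sub>R mul (G (j - 1)) (G j)"
  proof -
    have "F ?u = mul ((- a j) *\<^sub>R G (j - 1)) (G j) + mul (G j) ((- a j) *\<^sub>R G (j - 1))"
      by (simp only: op_mul[OF G_Hfin G_Hfin] F_G)
    also have "\<dots> = (- a j) *\<^sub>R mul (G (j - 1)) (G j) + (- a j) *\<^sub>R mul (G (j - 1)) (G j)"
      by (simp only: mul_scaleR_left mul_scaleR_right G_Hfin mul_commute[OF G_Hfin[of j] G_Hfin[of "j - 1"]])
    also have "\<dots> = (- 2 * a j) *\<^sub>R mul (G (j - 1)) (G j)"
      unfolding scaleR_left_distrib[symmetric] by simp
    finally show ?thesis .
  qed
  have Hu: "H ?u = (2 * (k + real j)) *\<^sub>R ?u"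
    by (simp add: op_mul[OF G_Hfin G_Hfin] H_G mul_scaleR_left mul_scaleR_right G_Hfin
        flip: scaleR_left_distrib)
  from norm_E_sq[OF mul_smooth[OF G_Hfin G_Hfin] Hu]
  show ?thesis unfolding Eu Fu by (simp add: power_mult_distrib algebra_simps)
qed

text \<open>By \<open>E_adjoint\<close> and \<open>F_G\<close>, the squared norm of
  \<open>G j\<close> is \<open>A j\<close> times that of \<open>f\<close>.\<close>

definition A :: "nat \<Rightarrow> real" where "A j = (\<Prod>i<j. a (Suc i))"

lemma A_pos: "A j > 0" unfolding A_def by (intro prod_pos) (auto simp: a_Suc_pos)

lemma A_Suc: "A (Suc j) = A j * a (Suc j)" by (simp add: A_def)

definition v :: "nat \<Rightarrow> 'a" where "v j = (1 / A j) *\<^sub>R U j j"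

lemma v_smooth: "v j \<in> smooth" unfolding v_def by (rule smooth_scaleR[OF U_smooth])

lemma H_v: "H (v j) = 0" unfolding v_def by (simp add: op_scaleR U_smooth H_U)

text \<open>Dividing by \<open>A j\<close> makes the tridiagonal matrix symmetric with row sums
  zero: a weighted discrete Laplacian on the half-line.\<close>

lemma casimir_v: "\<Delta> (v j) = (a j + a (Suc j)) *\<^sub>R v j - a (Suc j) *\<^sub>R v (Suc j) - a j *\<^sub>R v (j - 1)"
proof -
  have 1: "a (Suc j) *\<^sub>R v (Suc j) = (1 / A j) *\<^sub>R U (Suc j) (Suc j)"
    using a_Suc_pos[of j] by (simp add: v_def A_Suc)
  have 2: "a j *\<^sub>R v (j - 1) = ((a j)\<^sup>2 / A j) *\<^sub>R U (j - 1) (j - 1)"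
  proof (cases j)
    case (Suc i)
    thus ?thesis using a_Suc_pos[of i] by (simp add: v_def A_Suc power2_eq_square)
  qed simp
  show ?thesis unfolding 1 2
    by (simp add: v_def casimir_scaleR U_smooth casimir_U algebra_simps add_divide_distrib)
qed

lemma ip_v: "ip (v i) (v j) = of_real ((norm (mul (G i) (G j)))\<^sup>2 / (A i * A j))"
  unfolding v_def by (simp add: ip_simps ip_U del: of_real_power)

definition x :: "nat \<Rightarrow> real" where "x j = (norm (v j))\<^sup>2"
definition y :: "nat \<Rightarrow> real" where "y j = Re (ip (v j) (v (Suc j)))"

lemma x_eq: "x j = (norm (mul (G j) (G j)))\<^sup>2 / (A j)\<^sup>2"
  using ip_v[of j j] unfolding ip_self of_real_eq_iff x_def by (simp add: power2_eq_square)

lemma y_eq: "y j = (norm (mul (G j) (G (Suc j))))\<^sup>2 / (A j * A (Suc j))"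
  unfolding y_def ip_v by (rule Re_complex_of_real)

lemma x_nonneg: "x j \<ge> 0" by (simp add: x_def)

text \<open>This is \<open>norm_mul_G_Suc\<close> divided by the square of
  \<open>A j\<close>.\<close>

lemma y_rec: "a (Suc j) * y j = a j * y (j - 1) + (k + real j) * x j"
proof -
  have "a (Suc j) * y j = (norm (mul (G j) (G (Suc j))))\<^sup>2 / (A j)\<^sup>2"
    using a_Suc_pos[of j] by (simp add: y_eq A_Suc power2_eq_square)
  also have "\<dots> = (a j)\<^sup>2 * (norm (mul (G (j - 1)) (G j)))\<^sup>2 / (A j)\<^sup>2 + (k + real j) * x j"
    unfolding norm_mul_G_Suc x_eq by (simp add: add_divide_distrib)
  also have "(a j)\<^sup>2 * (norm (mul (G (j - 1)) (G j)))\<^sup>2 / (A j)\<^sup>2 = a j * y (j - 1)"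
  proof (cases j)
    case (Suc i)
    thus ?thesis using a_Suc_pos[of i] A_pos[of i] by (simp add: y_eq A_Suc power2_eq_square)
  qed simp
  finally show ?thesis .
qed

lemma Re_ip_v_nonneg: "Re (ip (v i) (v j)) \<ge> 0"
  unfolding ip_v Re_complex_of_real using A_pos less_imp_le
  by (intro divide_nonneg_nonneg mult_nonneg_nonneg) auto

lemma norm_F_v_sq: "(norm (F (v j)))\<^sup>2 \<le> (a j + a (Suc j)) * x j"
proof -
  have "complex_of_real ((norm (F (v j)))\<^sup>2) = ip (\<Delta> (v j)) (v j)"
    unfolding ip_self[symmetric] by (rule ip_casimir_weight_0[OF v_smooth H_v v_smooth, symmetric])
  hence "(norm (F (v j)))\<^sup>2 = Re (ip (\<Delta> (v j)) (v j))" by (metis Re_complex_of_real)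
  also have "\<dots> = (a j + a (Suc j)) * x j - a (Suc j) * Re (ip (v (Suc j)) (v j))
      - a j * Re (ip (v (j - 1)) (v j))"
    unfolding casimir_v x_def by (simp add: ip_simps ip_self del: of_real_power)
  also have "\<dots> \<le> (a j + a (Suc j)) * x j"
    using mult_nonneg_nonneg[OF a_nonneg Re_ip_v_nonneg] by (smt (verit))
  finally show ?thesis .
qed

text \<open>Pairing the recurrence for \<open>v j\<close> with \<open>v (Suc j)\<close> isolates
  \<open>x (Suc j)\<close>. The Gram form of \<open>F\<close> is bounded by Cauchy-Schwarz, and the
  term in \<open>v (j - 1)\<close> has a favourable sign.\<close>

lemma x_Suc_le:
  "a (Suc j) * x (Suc j) \<le> norm (F (v j)) * norm (F (v (Suc j))) + (a j + a (Suc j)) * y j"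
proof -
  have "- Re (ip (F (v j)) (F (v (Suc j)))) \<le> norm (F (v j)) * norm (F (v (Suc j)))"
    using cauchy_schwarz abs_Re_le_cmod by (smt (verit))
  moreover have "Re (ip (F (v j)) (F (v (Suc j)))) = (a j + a (Suc j)) * y j - a (Suc j) * x (Suc j)
      - a j * Re (ip (v (j - 1)) (v (Suc j)))"
    unfolding ip_casimir_weight_0[OF v_smooth H_v v_smooth, symmetric] casimir_v x_def y_def
    by (simp add: ip_simps ip_self del: of_real_power)
  ultimately show ?thesis using mult_nonneg_nonneg[OF a_nonneg Re_ip_v_nonneg] by (smt (verit))
qed

lemma x_le: "x j \<le> max (x 0) (x 1) * 16 ^ j"
  by (rule geometric_growth[OF k a_def x_nonneg norm_ge_zero y_rec norm_F_v_sq x_Suc_le])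

lemma norm_v_le: "norm (v j) \<le> sqrt (max (x 0) (x 1)) * 4 ^ j"
proof -
  have "norm (v j) = sqrt (x j)" by (simp add: x_def)
  also have "\<dots> \<le> sqrt (max (x 0) (x 1) * 16 ^ j)" by (intro real_sqrt_le_mono x_le)
  also have "sqrt (16 ^ j) = (4 ^ j :: real)"
    by (rule real_sqrt_unique) (auto simp: power_mult[symmetric] mult.commute[of j] power_mult)
  hence "sqrt (max (x 0) (x 1) * 16 ^ j) = sqrt (max (x 0) (x 1)) * 4 ^ j"
    by (simp add: real_sqrt_mult)
  finally show ?thesis .
qed

text \<open>Each Casimir operator raises the index by at most one and has total absolute coefficient
  \<open>2 * a j + 2 * a (Suc j)\<close>, at most \<open>4 * a (Suc j)\<close>. This gives
  \<open>4 ^ n\<close> and the product, while \<open>4 ^ (j + n)\<close> bounds the vectors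
  reached.\<close>

lemma norm_casimir_pow_v_le:
  "norm ((\<Delta> ^^ n) (v j)) \<le> sqrt (max (x 0) (x 1)) * 4 ^ (j + n) * 4 ^ n * (\<Prod>i<n. a (Suc (j + i)))"
proof (induction n arbitrary: j)
  case 0
  show ?case using norm_v_le[of j] by simp
next
  case (Suc n)
  define M where "M = sqrt (max (x 0) (x 1))"
  have M: "M \<ge> 0" unfolding M_def using x_nonneg[of 0] by simp
  \<comment> \<open>The induction hypothesis at index \<open>Suc j\<close>; by monotonicity of
    \<open>a\<close> it also dominates those at \<open>j\<close> and \<open>j - 1\<close>.\<close>
  define R where "R = M * 4 ^ (Suc j + n) * 4 ^ n * (\<Prod>i<n. a (Suc (Suc j + i)))"
  have R0: "R \<ge> 0" unfolding R_def using M a_nonneg by (intro mult_nonneg_nonneg prod_nonneg) auto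
  have R: "norm ((\<Delta> ^^ n) (v i)) \<le> R" if "i \<le> Suc j" for i
  proof -
    have "norm ((\<Delta> ^^ n) (v i)) \<le> M * 4 ^ (i + n) * 4 ^ n * (\<Prod>m<n. a (Suc (i + m)))"
      unfolding M_def by (rule Suc)
    also have "\<dots> \<le> R" unfolding R_def
    proof (intro mult_mono prod_mono conjI)
      show "(4::real) ^ (i + n) \<le> 4 ^ (Suc j + n)" using that by (intro power_increasing) auto
    qed (use M a_nonneg that in \<open>auto intro!: a_mono prod_nonneg mult_nonneg_nonneg\<close>)
    finally show ?thesis .
  qed
  let ?p = "(a j + a (Suc j)) *\<^sub>R (\<Delta> ^^ n) (v j)" and ?q = "a (Suc j) *\<^sub>R (\<Delta> ^^ n) (v (Suc j))"
    and ?r = "a j *\<^sub>R (\<Delta> ^^ n) (v (j - 1))"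
  \<comment> \<open>One Casimir operator is split off innermost, so that the recurrence leads to
    \<open>n\<close>-th powers at the neighbours of \<open>j\<close>.\<close>
  have "(\<Delta> ^^ Suc n) (v j) = (\<Delta> ^^ n) (\<Delta> (v j))" by (simp only: funpow_Suc_right o_apply)
  also have "\<dots> = ?p - ?q - ?r"
    unfolding casimir_v
    by (simp add: casimir_pow_diff casimir_pow_scaleR smooth_intros v_smooth)
  finally have "norm ((\<Delta> ^^ Suc n) (v j)) \<le> norm ?p + norm ?q + norm ?r"
    by (smt (verit) norm_triangle_ineq4)
  also have "\<dots> \<le> (a j + a (Suc j)) * R + a (Suc j) * R + a j * R"
    unfolding norm_scaleR using a_nonneg R[of j] R[of "Suc j"] R[of "j - 1"]
    by (intro add_mono mult_mono) auto
  also have "\<dots> = (2 * a j + 2 * a (Suc j)) * R" by (simp add: algebra_simps)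
  also have "\<dots> \<le> (4 * a (Suc j)) * R" using a_mono[of j "Suc j"] R0 by (intro mult_right_mono) auto
  also have "\<dots> = M * 4 ^ (j + Suc n) * 4 ^ Suc n * (\<Prod>i<Suc n. a (Suc (j + i)))"
    unfolding R_def prod.lessThan_Suc_shift by (simp add: mult_ac)
  finally show ?case unfolding M_def .
qed

text \<open>With \<open>c = 1/8\<close> the series weight \<open>(2 * c) ^ (2 * n)\<close> cancels
  the factor \<open>4 ^ n * 4 ^ n\<close> from the bound at \<open>j = 0\<close>, leaving
  \<open>summable_rising_product\<close>.\<close>

theorem exp_casimir_norm_finite:
  "fun_casimir_finite J ip \<pi> (\<lambda>l. complex_of_real (exp (1/8 * sqrt l))) (mul f (cj f))"
proof (rule exp_casimir_finite)
  define M where "M = sqrt (max (x 0) (x 1))"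
  have v0: "mul f (cj f) = v 0" by (simp add: v_def U_def G_def A_def)
  show "mul f (cj f) \<in> smooth" unfolding v0 by (rule v_smooth)
  show "summable (\<lambda>n. (2 * (1/8)) ^ (2 * n) / fact (2 * n) * norm ((\<Delta> ^^ n) (mul f (cj f))))"
  proof (rule summable_comparison_test')
    show "summable (\<lambda>n. M * ((\<Prod>i<n. real (Suc i) * (2 * k + real (Suc i) - 1)) / fact (2 * n)))"
      by (rule summable_mult[OF summable_rising_product[OF k]])
    fix n
    have "(2 * (1/8)) ^ (2 * n) / fact (2 * n) * norm ((\<Delta> ^^ n) (v 0))
        \<le> (2 * (1/8)) ^ (2 * n) / fact (2 * n) * (M * 4 ^ (0 + n) * 4 ^ n * (\<Prod>i<n. a (Suc (0 + i))))"
      unfolding M_def by (intro mult_left_mono norm_casimir_pow_v_le) auto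
    also have "\<dots> = ((1/4) ^ (2 * n) * 4 ^ (2 * n)) * M * (\<Prod>i<n. a (Suc i)) / fact (2 * n)"
      by (simp add: mult_2 power_add)
    also have "\<dots> = M * ((\<Prod>i<n. real (Suc i) * (2 * k + real (Suc i) - 1)) / fact (2 * n))"
      by (simp add: power_mult_distrib[symmetric] a_def)
    finally show "norm ((2 * (1/8)) ^ (2 * n) / fact (2 * n) * norm ((\<Delta> ^^ n) (mul f (cj f))))
        \<le> M * ((\<Prod>i<n. real (Suc i) * (2 * k + real (Suc i) - 1)) / fact (2 * n))"
      unfolding v0 by simp
  qed
qed simp

end

text \<open>Symmetry of \<open>H\<close> makes the weight real. As \<open>F f = 0\<close>, the
  squared norm of \<open>E f\<close> is \<open>2 * k\<close> times that of \<open>f\<close>, so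
  \<open>k\<close> is nonnegative, and it is nonzero by definition.\<close>

lemma (in multiplicative_representation) lowest_weight_positive:
  assumes f: "f \<in> Hfin" "lowest_weight_vector J \<pi> f"
  obtains k where "k > 0" "H f = k *\<^sub>R f"
proof -
  obtain n where n: "n \<noteq> 0" "H f = cscale J n f" "F f = 0" "f \<noteq> 0"
    using f(2) unfolding lowest_weight_vector_def by blast
  have fs: "f \<in> smooth" by (rule Hfin_smooth[OF f(1)])
  have "n * ip f f = cnj n * ip f f"
    using H_symmetric[OF fs fs] n(2) by (simp add: ip_simps)
  hence "n = cnj n" using n(4) by (simp add: ip_self)
  then obtain k where k: "n = of_real k" by (metis Reals_cnj_iff Reals_cases)
  hence Hf: "H f = k *\<^sub>R f" using n(2) by (simp add: cscale_of_real)
  have "0 \<le> 2 * k * (norm f)\<^sup>2" using norm_E_sq[OF fs Hf] n(3) by (metis add_0 norm_zero power_zero_numeral zero_le_power2)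
  hence "k \<ge> 0" using n(4) by (simp add: zero_le_mult_iff)
  hence "k > 0" using k n(1) by (cases "k = 0") auto
  thus ?thesis using that Hf by blast
qed

theorem theorem11p10:
  fixes J :: "'h::{real_normed_vector,banach} \<Rightarrow> 'h"
    and ip :: "'h \<Rightarrow> 'h \<Rightarrow> complex"
    and \<pi> :: "real^2^2 \<Rightarrow> 'h \<Rightarrow> 'h"
    and Hfin :: "'h set"
    and mul :: "'h \<Rightarrow> 'h \<Rightarrow> 'h"
    and one :: 'h
  assumes "multiplicative_rep J ip \<pi> Hfin mul one"
  shows "\<exists>c>0. \<forall>f\<in>Hfin. lowest_weight_vector J \<pi> f \<longrightarrow>
           fun_casimir_finite J ip \<pi> (\<lambda>l. complex_of_real (exp (c * sqrt l)))
             (mul f (conjv ip Hfin mul f))"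
\<comment> \<open>One witness serves all \<open>f\<close>, because the growth bases 4 are
  independent of the weight \<open>k\<close>; the weight enters only the value of the convergent
  series.\<close>
proof (intro exI[of _ "1/8"] conjI ballI impI)
  fix f assume f: "f \<in> Hfin" "lowest_weight_vector J \<pi> f"
  interpret multiplicative_representation J ip \<pi> Hfin mul one
    by unfold_locales (rule assms)
  obtain k where k: "k > 0" "opH J \<pi> f = k *\<^sub>R f" using lowest_weight_positive[OF f] .
  interpret lowest_weight J ip \<pi> Hfin mul one f k
    by unfold_locales (use f k in \<open>auto simp: lowest_weight_vector_def\<close>)
  show "fun_casimir_finite J ip \<pi> (\<lambda>l. complex_of_real (exp (1/8 * sqrt l)))
      (mul f (conjv ip Hfin mul f))"
    by (rule exp_casimir_norm_finite)
qed simp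

end
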